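(* Let $G$ be a finite simple graph with maximum degree $\Delta\le 5$. If $\mathrm{mad}(G)<2+\frac{12}{29}$, then $\chi_\ell(G^2)\le 6$.
   Context: Graphs are finite and simple. The square $G^2$ of a graph $G$ has vertex set $V(G)$, with two distinct vertices adjacent in $G^2$ iff their distance in $G$ is at most $2$. The maximum average degree is $\mathrm{mad}(G)=\max_{H\subseteq G}\frac{2|E(H)|}{|V(H)|}$, the maximum over all (nonempty) subgraphs $H$ of $G$. A list-assignment $L$ gives each vertex $v$ a set $L(v)$ of colors; an $L$-coloring is a proper coloring in which each vertex $v$ gets a color from $L(v)$. The choice number $\chi_\ell(H)$ of a graph $H$ is the minimum $k$ such that $H$ has an $L$-coloring for every list-assignment $L$ with $|L(v)|\ge k$ for every vertex $v$. *)

theory Defs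
  imports "Graph_Theory.Graph_Theory"
begin

text \<open>
  Finite simple graphs are the library's \<open>pair_graph\<close>s: finite, loop-free, symmetric digraphs whose
  arcs are ordered pairs of vertices. An undirected edge \<open>{u, v}\<close> is thus represented by the two
  arcs \<open>(u, v)\<close> and \<open>(v, u)\<close>.
\<close>

definition uedges :: "'a pair_pre_digraph \<Rightarrow> 'a set set" where
  "uedges G = (\<lambda>(u, v). {u, v}) ` parcs G"

text \<open>
  By symmetry, the out-degree in the digraph is the degree in the undirected graph. The element \<open>0\<close>
  only matters for the null graph, whose maximum degree is thereby \<open>0\<close>; likewise in \<open>mad\<close>.
\<close>

definition max_degree :: "'a pair_pre_digraph \<Rightarrow> nat" where
  "max_degree G = Max (insert 0 ((\<lambda>v. out_degree (with_proj G) v) ` pverts G))"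

text \<open>
  \<open>subgraph\<close> alone would also admit non-symmetric sub-digraphs, hence the condition \<open>pair_graph H\<close>.
\<close>

definition mad :: "'a pair_pre_digraph \<Rightarrow> real" where
  "mad G = Max (insert 0
     {2 * real (card (uedges H)) / real (card (pverts H)) | H.
        pair_graph H \<and> subgraph (with_proj H) (with_proj G) \<and> pverts H \<noteq> {}})"

text \<open>The maximum in \<open>mad\<close> ranges over a finite set.\<close>

lemma finite_subgraphs:
  assumes "pair_graph G"
  shows "finite {H. pair_graph H \<and> subgraph (with_proj H) (with_proj G)}"
proof -
  interpret pair_graph G by (fact assms)
  let ?S = "{H. pair_graph H \<and> subgraph (with_proj H) (with_proj G)}"
  have "inj_on (\<lambda>H. (pverts H, parcs H)) ?S"
    by (auto simp: inj_on_def)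
  moreover have "(\<lambda>H. (pverts H, parcs H)) ` ?S \<subseteq> Pow (pverts G) \<times> Pow (parcs G)"
    by (auto simp: subgraph_def)
  then have "finite ((\<lambda>H. (pverts H, parcs H)) ` ?S)"
    by (rule finite_subset) (simp add: pair_finite_verts pair_finite_arcs)
  ultimately show ?thesis by (simp add: finite_image_iff)
qed

text \<open>
  Distance is the length of a shortest walk, i.e. the library's shortest-path cost for unit weights
  (\<open>\<infinity>\<close> if there is no walk).
\<close>

definition distance :: "'a pair_pre_digraph \<Rightarrow> 'a \<Rightarrow> 'a \<Rightarrow> ereal" where
  "distance G u v = wf_digraph.\<mu> (with_proj G) (\<lambda>_. 1) u v"

definition square :: "'a pair_pre_digraph \<Rightarrow> 'a pair_pre_digraph" where
  "square G = \<lparr> pverts = pverts G,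
     parcs = {(u, v). u \<in> pverts G \<and> v \<in> pverts G \<and> u \<noteq> v \<and> distance G u v \<le> 2} \<rparr>"

definition list_coloring ::
    "'a pair_pre_digraph \<Rightarrow> ('a \<Rightarrow> 'c set) \<Rightarrow> ('a \<Rightarrow> 'c) \<Rightarrow> bool" where
  "list_coloring G L c \<longleftrightarrow>
     (\<forall>v \<in> pverts G. c v \<in> L v) \<and> (\<forall>(u, v) \<in> parcs G. c u \<noteq> c v)"

text \<open>
  Colors are natural numbers; \<open>choosable_any_colors\<close> below shows that for finite graphs this is no
  restriction. An infinite list has \<open>card = 0\<close> but counts as having at least \<open>k\<close> elements.
\<close>

definition choosable :: "'a pair_pre_digraph \<Rightarrow> nat \<Rightarrow> bool" where
  "choosable G k \<longleftrightarrow>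
     (\<forall>L :: 'a \<Rightarrow> nat set.
        (\<forall>v \<in> pverts G. infinite (L v) \<or> k \<le> card (L v)) \<longrightarrow> (\<exists>c. list_coloring G L c))"

definition choice_number :: "'a pair_pre_digraph \<Rightarrow> nat" where
  "choice_number G = (LEAST k. choosable G k)"

lemma choosable_any_colors:
  fixes L :: "'a \<Rightarrow> 'c set"
  assumes G: "pair_graph G" and ch: "choosable G k"
    and L: "\<And>v. v \<in> pverts G \<Longrightarrow> infinite (L v) \<or> k \<le> card (L v)"
  shows "\<exists>c. list_coloring G L c"
proof -
  interpret pair_graph G by (fact G)
  have "\<exists>S. S \<subseteq> L v \<and> finite S \<and> card S = k" if "v \<in> pverts G" for v
    using L[OF that] by (metis infinite_arbitrarily_large obtain_subset_with_card_n)
  then obtain S where S: "\<And>v. v \<in> pverts G \<Longrightarrow> S v \<subseteq> L v \<and> finite (S v) \<and> card (S v) = k"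
    by metis
  define U where "U = (\<Union>v \<in> pverts G. S v)"
  have "finite U" using S by (auto simp: U_def)
  then obtain f :: "'c \<Rightarrow> nat" where f: "inj_on f U"
    using finite_imp_inj_to_nat_seg by metis
  have SU: "S v \<subseteq> U" if "v \<in> pverts G" for v using that by (auto simp: U_def)
  have "card (f ` S v) = k" if "v \<in> pverts G" for v
    using S[OF that] card_image[OF inj_on_subset[OF f SU[OF that]]] by simp
  then obtain c where c: "list_coloring G (\<lambda>v. f ` S v) c"
    using ch unfolding choosable_def by (metis order_refl)
  have "list_coloring G L (\<lambda>v. inv_into U f (c v))"
    unfolding list_coloring_def
  proof (intro conjI ballI)
    fix v assume v: "v \<in> pverts G"
    then obtain x where "x \<in> S v" "c v = f x" using c by (auto simp: list_coloring_def)
    then show "inv_into U f (c v) \<in> L v"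
      using S[OF v] SU[OF v] inv_into_f_f[OF f, of x] by (simp add: subset_iff)
  next
    fix e assume e: "e \<in> parcs G"
    obtain u v where uv: "e = (u, v)" by (cases e)
    have in_im: "c w \<in> f ` U" if "w \<in> pverts G" for w
    proof -
      have "c w \<in> f ` S w" using c that by (simp add: list_coloring_def)
      then show ?thesis using image_mono[OF SU[OF that]] by (rule rev_subsetD)
    qed
    have "u \<in> pverts G" "v \<in> pverts G" using e uv in_arcsD1 in_arcsD2 by metis+
    moreover have "c u \<noteq> c v" using c e uv by (auto simp: list_coloring_def)
    ultimately have "inv_into U f (c u) \<noteq> inv_into U f (c v)"
      by (metis in_im inv_into_injective)
    then show "case e of (u, v) \<Rightarrow> inv_into U f (c u) \<noteq> inv_into U f (c v)"
      using uv by simp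
  qed
  then show ?thesis by blast
qed

text \<open>The minimum in \<open>choice_number\<close> exists for every finite simple graph.\<close>

lemma choosable_card_verts:
  assumes "pair_graph G"
  shows "choosable G (card (pverts G))"
  unfolding choosable_def
proof (intro allI impI)
  interpret pair_graph G by (fact assms)
  fix L :: "'a \<Rightarrow> nat set"
  assume L: "\<forall>v \<in> pverts G. infinite (L v) \<or> card (pverts G) \<le> card (L v)"
  have "\<exists>c. (\<forall>v \<in> A. c v \<in> L v) \<and> inj_on c A" if "A \<subseteq> pverts G" for A
    using finite_subset[OF that pair_finite_verts] that
  proof (induction A rule: finite_induct)
    case empty
    then show ?case by simp
  next
    case (insert x A)
    then obtain c where c: "\<forall>v \<in> A. c v \<in> L v" "inj_on c A" by auto
    have "card (c ` A) < card (pverts G)"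
    proof -
      have "card (insert x A) \<le> card (pverts G)"
        using insert.prems by (intro card_mono pair_finite_verts)
      then show ?thesis using insert.hyps card_image_le[of A c] by simp
    qed
    then have "\<not> L x \<subseteq> c ` A"
    proof -
      have "x \<in> pverts G" using insert.prems by simp
      then consider "infinite (L x)" | "card (pverts G) \<le> card (L x)" using L by blast
      then show ?thesis
      proof cases
        case 1
        then show ?thesis using insert.hyps(1) finite_subset by blast
      next
        case 2
        then have "card (c ` A) < card (L x)" using \<open>card (c ` A) < card (pverts G)\<close> by linarith
        then show ?thesis using insert.hyps(1) card_mono[of "c ` A" "L x"] by fastforce
      qed
    qed
    then obtain y where y: "y \<in> L x" "y \<notin> c ` A" by blast
    have "(\<forall>v \<in> insert x A. (c(x := y)) v \<in> L v) \<and> inj_on (c(x := y)) (insert x A)"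
      using c y insert.hyps(2) by (auto simp: inj_on_def)
    then show ?case by blast
  qed
  then obtain c where c: "\<forall>v \<in> pverts G. c v \<in> L v" "inj_on c (pverts G)" by blast
  have "list_coloring G L c"
    unfolding list_coloring_def
  proof (intro conjI ballI)
    fix e assume e: "e \<in> parcs G"
    obtain u v where uv: "e = (u, v)" by (cases e)
    then have "u \<noteq> v" "u \<in> pverts G" "v \<in> pverts G"
      using e pair_no_loops[OF e] wellformed' by auto
    then show "case e of (u, v) \<Rightarrow> c u \<noteq> c v"
      using c(2) uv by (simp add: inj_on_eq_iff)
  qed (use c in blast)
  then show "\<exists>c. list_coloring G L c" by blast
qed

lemma pair_graph_square:
  assumes "pair_graph G"
  shows "pair_graph (square G)"
proof -
  interpret pair_graph G by (fact assms)
  have len: "length (rev_path p) = length p" for p :: "('a \<times> 'a) list"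
    by (induction p) auto
  have le: "distance G v u \<le> distance G u v" for u v
    unfolding distance_def \<mu>_def
  proof (rule INF_mono)
    fix p assume "p \<in> {p. awalk u p v}"
    then show "\<exists>q \<in> {p. awalk v p u}. ereal (awalk_cost (\<lambda>_. 1) q) \<le> ereal (awalk_cost (\<lambda>_. 1) p)"
      by (intro bexI[of _ "rev_path p"])
         (auto simp: awalk_cost_def sum_list_triv len)
  qed
  have sub: "parcs (square G) \<subseteq> pverts G \<times> pverts G" by (auto simp: square_def)
  have "finite (parcs (square G))"
    using sub by (rule finite_subset) (simp add: pair_finite_verts)
  moreover have "sym (parcs (square G))"
    using le by (auto simp: square_def sym_def intro: order_trans)
  ultimately show ?thesis
    by unfold_locales (auto simp: symmetric_def square_def pair_finite_verts)
qed

end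

theory Submission
  imports Defs
begin

text \<open>
  In a minimal counterexample \<open>(V, E)\<close> write \<open>d v\<close> for the degree and \<open>D v\<close> for the sum of the degrees of
  the neighbours, which bounds the degree in the square. Deleting an edge inside \<open>S\<close> and colouring the
  rest by minimality leaves a list-colouring problem on \<open>S\<close> alone, so \<open>S\<close> cannot be coloured greedily;
  this excludes many configurations of vertices of degree 2 and 3. A cycle formed by 3-threads (paths
  with three inner vertices of degree 2) between 5-vertices, or by 2-threads between 4-vertices, reduces
  to list-colouring an even cycle from lists of size 2. Hence there are no more such threads than
  5-vertices, respectively 4-vertices.

  Give \<open>v\<close> the charge \<open>29 * d v - 70\<close>. Let each 5-vertex send 13 and each 4-vertex send 11 along every
  edge, keeping 10 and 2; all other vertices then end up nonnegative, except for the ends of those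
  threads, whose deficits are paid by what the 5- and 4-vertices kept. So the total charge is
  nonnegative, against \<open>mad G < 70 / 29\<close>.
\<close>

subsection \<open>List colouring of even cycles\<close>

lemma even_card_involution:
  assumes "finite C" "\<And>c. c \<in> C \<Longrightarrow> \<tau> c \<in> C \<and> \<tau> (\<tau> c) = c \<and> \<tau> c \<noteq> c"
  shows "even (card C)"
  using assms
proof (induction "card C" arbitrary: C rule: less_induct)
  case less
  show ?case
  proof (cases "C = {}")
    case False
    then obtain c where c: "c \<in> C" by blast
    let ?C = "C - {c, \<tau> c}"
    have 1: "card C = card ?C + 2"
      using less.prems c card_Diff_subset[of "{c, \<tau> c}" C] card_mono[of C "{c, \<tau> c}"] by force
    have "even (card ?C)"
    proof (rule less.hyps)
      show "card ?C < card C" using 1 by simp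
      show "finite ?C" using less.prems by simp
      fix x assume x: "x \<in> ?C"
      then have "\<tau> x \<noteq> c" "\<tau> x \<noteq> \<tau> c" using less.prems(2) c by (metis DiffE insertCI)+
      then show "\<tau> x \<in> ?C \<and> \<tau> (\<tau> x) = x \<and> \<tau> x \<noteq> x" using x less.prems(2) by auto
    qed
    then show ?thesis using 1 by simp
  qed simp
qed

text \<open>The union of the two perfect matchings \<open>\<tau>\<close> and \<open>\<sigma>\<close>
  of \<open>C\<close> is a disjoint union of even cycles, a pair matched by both being a cycle of
  length 2, so this is the 2-choosability of even cycles. Several cycles are split apart. A single
  one is shortened at a pair with equal lists, or coloured greedily from a vertex whose list differs
  from that of its \<open>\<tau>\<close>-partner.\<close>

lemma two_matchings_list_colorable:
  assumes "finite C"
    and "\<And>c. c \<in> C \<Longrightarrow> \<tau> c \<in> C \<and> \<tau> (\<tau> c) = c \<and> \<tau> c \<noteq> c"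
    and "\<And>c. c \<in> C \<Longrightarrow> \<sigma> c \<in> C \<and> \<sigma> (\<sigma> c) = c \<and> \<sigma> c \<noteq> c"
    and "\<And>c. c \<in> C \<Longrightarrow> card (L c) = 2"
  shows "\<exists>f. \<forall>c\<in>C. f c \<in> L c \<and> f (\<tau> c) \<noteq> f c \<and> f (\<sigma> c) \<noteq> f c"
  using assms
proof (induction "card C" arbitrary: C \<sigma> rule: less_induct)
  case less
  note fin = less.prems(1) and tau = less.prems(2) and sig = less.prems(3) and L = less.prems(4)
  consider (empty) "C = {}"
    | (split) B where "B \<subseteq> C" "B \<noteq> {}" "B \<noteq> C" "\<And>b. b \<in> B \<Longrightarrow> \<tau> b \<in> B \<and> \<sigma> b \<in> B"
    | (contract) c where "c \<in> C" "L c = L (\<tau> c)" "C \<noteq> {}"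
        "\<And>B. B \<subseteq> C \<Longrightarrow> B \<noteq> {} \<Longrightarrow> B \<noteq> C \<Longrightarrow> \<exists>b\<in>B. \<tau> b \<notin> B \<or> \<sigma> b \<notin> B"
    | (diff) c where "c \<in> C" "L c \<noteq> L (\<tau> c)"
        "\<And>B. B \<subseteq> C \<Longrightarrow> B \<noteq> {} \<Longrightarrow> B \<noteq> C \<Longrightarrow> \<exists>b\<in>B. \<tau> b \<notin> B \<or> \<sigma> b \<notin> B"
    by (metis all_not_in_conv)
  then show ?case
  proof cases
    case empty
    then show ?thesis by simp
  next
    case split
    have B: "card B < card C" using split fin by (simp add: psubset_card_mono psubset_eq)
    have B': "card (C - B) < card C"
      using split fin by (metis Diff_subset card_mono card_Diff_subset finite_subset
          card_gt_0_iff diff_less B less_nat_zero_code not_gr_zero)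
    obtain f where f: "\<forall>c\<in>B. f c \<in> L c \<and> f (\<tau> c) \<noteq> f c \<and> f (\<sigma> c) \<noteq> f c"
    proof -
      have "\<exists>f. \<forall>c\<in>B. f c \<in> L c \<and> f (\<tau> c) \<noteq> f c \<and> f (\<sigma> c) \<noteq> f c"
        by (rule less.hyps[OF B])
           (use split fin tau sig L finite_subset[of B C] in \<open>auto simp: subset_iff\<close>)
      then show ?thesis using that by blast
    qed
    have cl: "\<tau> c \<in> C - B \<and> \<sigma> c \<in> C - B" if "c \<in> C - B" for c
      using that split(4)[of "\<tau> c"] split(4)[of "\<sigma> c"] tau[of c] sig[of c] by auto
    obtain g where g: "\<forall>c\<in>C - B. g c \<in> L c \<and> g (\<tau> c) \<noteq> g c \<and> g (\<sigma> c) \<noteq> g c"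
    proof -
      have "\<exists>f. \<forall>c\<in>C - B. f c \<in> L c \<and> f (\<tau> c) \<noteq> f c \<and> f (\<sigma> c) \<noteq> f c"
        by (rule less.hyps[OF B'])
           (use split fin tau sig L cl in auto)
      then show ?thesis using that by blast
    qed
    show ?thesis
      by (rule exI[of _ "\<lambda>c. if c \<in> B then f c else g c"]) (use f g split(4) cl in auto)
  next
    case contract
    let ?e = "\<tau> c" and ?d = "\<sigma> c"
    have e: "?e \<in> C" "\<tau> ?e = c" "?e \<noteq> c" using tau contract(1) by auto
    obtain a b where ab: "L c = {a, b}" "a \<noteq> b" using L[OF contract(1)] by (auto simp: card_2_iff)
    \<comment> \<open>Since \<open>c\<close> and \<open>\<tau> c\<close> have the same list of size 2, they can be coloured as soon as their outer
      neighbours have different colours, so we may contract them and match those neighbours.\<close>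
    show ?thesis
    proof (cases "?d = ?e")
      case True
      then have "\<sigma> ?e = c" using sig contract(1) by metis
      then have "C = {c, ?e}" using contract(4)[of "{c, ?e}"] True contract(1) e by auto
      then show ?thesis
        by (intro exI[of _ "\<lambda>x. if x = c then a else b"]) (use ab contract(2) True e \<open>\<sigma> ?e = c\<close> in auto)
    next
      case False
      let ?g = "\<sigma> ?e" and ?C = "C - {c, \<tau> c}"
      let ?s = "\<sigma>(?d := ?g, ?g := ?d)"
      have d: "?d \<in> ?C" "\<sigma> ?d = c" using sig[OF contract(1)] False by auto
      have g: "?g \<in> ?C" "\<sigma> ?g = ?e" using sig[OF e(1)] d False by auto
      have dg: "?d \<noteq> ?g" using d g e by auto
      have tC: "\<tau> x \<in> ?C" if "x \<in> ?C" for x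
        using that tau[of x] tau[OF contract(1)] by auto
      have sC: "\<sigma> x \<in> ?C" if "x \<in> ?C" "x \<noteq> ?d" "x \<noteq> ?g" for x
        using that sig[of x] by auto
      have "\<exists>f. \<forall>x\<in>?C. f x \<in> L x \<and> f (\<tau> x) \<noteq> f x \<and> f (?s x) \<noteq> f x"
      proof (rule less.hyps)
        show "card ?C < card C" using contract(1) fin by (metis Diff_subset Diff_iff insertI1 psubset_card_mono psubset_eq)
        show "finite ?C" using fin by simp
        show "\<tau> x \<in> ?C \<and> \<tau> (\<tau> x) = x \<and> \<tau> x \<noteq> x" if "x \<in> ?C" for x
          using tC[OF that] that tau by auto
        show "?s x \<in> ?C \<and> ?s (?s x) = x \<and> ?s x \<noteq> x" if x: "x \<in> ?C" for x
        proof (cases "x = ?d \<or> x = ?g")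
          case True
          then show ?thesis using d g dg by auto
        next
          case False
          then have "\<sigma> x \<in> ?C" "\<sigma> x \<noteq> ?d" "\<sigma> x \<noteq> ?g" using sC[of x] x sig[of x] d g by (auto; metis)+
          then show ?thesis using False x sig[of x] by auto
        qed
        show "card (L x) = 2" if "x \<in> ?C" for x using L that by auto
      qed
      then obtain f where f: "\<forall>x\<in>?C. f x \<in> L x \<and> f (\<tau> x) \<noteq> f x \<and> f (?s x) \<noteq> f x" by blast
      have "f (?s ?d) \<noteq> f ?d" using f d by blast
      then have fdg: "f ?d \<noteq> f ?g" using dg by simp
      \<comment> \<open>If both ways of distributing \<open>a\<close> and \<open>b\<close> failed,
        \<open>f ?d\<close> and \<open>f ?g\<close> would be equal.\<close>
      obtain p q where pq: "p \<in> {a, b}" "q \<in> {a, b}" "p \<noteq> q" "p \<noteq> f ?d" "q \<noteq> f ?g"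
        using fdg ab(2) by (metis insertCI)
      let ?f = "f(c := p, ?e := q)"
      have "?f x \<in> L x \<and> ?f (\<tau> x) \<noteq> ?f x \<and> ?f (\<sigma> x) \<noteq> ?f x" if x: "x \<in> C" for x
      proof (cases "x \<in> ?C")
        case True
        then have "f x \<in> L x" "f (\<tau> x) \<noteq> f x" "\<tau> x \<in> ?C" using f tC by auto
        moreover have "?f (\<sigma> x) \<noteq> f x"
        proof (cases "x = ?d \<or> x = ?g")
          case True
          then show ?thesis using d g e pq by auto
        next
          case F: False
          then have "\<sigma> x \<in> ?C" using sC True by blast
          moreover have "f (?s x) \<noteq> f x" using f True by blast
          then have "f (\<sigma> x) \<noteq> f x" using F by simp
          ultimately show ?thesis by auto
        qed
        ultimately show ?thesis using True by auto
      next
        case False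
        then have "x = c \<or> x = ?e" using x by blast
        then show ?thesis using d g e pq ab contract(2) by auto
      qed
      then show ?thesis by blast
    qed
  next
    case diff
    let ?e = "\<tau> c" and ?d = "\<sigma> c"
    have e: "?e \<in> C" "\<tau> ?e = c" "?e \<noteq> c" using tau diff(1) by auto
    have d: "?d \<in> C" "\<sigma> ?d = c" "?d \<noteq> c" using sig diff(1) by auto
    have finL: "finite (L v)" if "v \<in> C" for v using L[OF that] card.infinite by fastforce
    obtain x where x: "x \<in> L c" "x \<notin> L ?e"
      using card_subset_eq[of "L ?e" "L c"] L diff(1,2) e(1) finL by auto
    \<comment> \<open>Colour \<open>c\<close> with \<open>x\<close>, which is harmless for \<open>\<tau> c\<close>. The rest is then degenerate: by minimality and
      parity, no nonempty subset avoiding \<open>c\<close> is closed under \<open>\<tau>\<close> and, except at \<open>\<sigma> c\<close>, under \<open>\<sigma>\<close>.\<close>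
    define L' where "L' v = L v - (if v = ?d then {x} else {})" for v
    have "\<exists>f. \<forall>v\<in>W. f v \<in> L' v \<and> (\<forall>w\<in>W. w = \<tau> v \<or> w = \<sigma> v \<longrightarrow> f w \<noteq> f v)"
      if "W \<subseteq> C - {c}" for W
      using finite_subset[OF that finite_Diff[OF fin]] that
    proof (induction "card W" arbitrary: W rule: less_induct)
      case (less W)
      show ?case
      proof (cases "W = {}")
        case True then show ?thesis by simp
      next
        case False
        have WC: "v \<in> C" "v \<noteq> c" if "v \<in> W" for v using less.prems that by auto
        have "\<exists>v\<in>W. card ({\<tau> v, \<sigma> v} \<inter> W) < card (L' v)"
        proof (rule ccontr)
          assume "\<not> ?thesis"
          then have le: "card (L' v) \<le> card ({\<tau> v, \<sigma> v} \<inter> W)" if "v \<in> W" for v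
            using that by (simp add: not_less)
          have cl: "\<tau> v \<in> W \<and> \<sigma> v \<in> W" if "v \<in> W" "v \<noteq> ?d \<or> v = ?e" for v
          proof -
            \<comment> \<open>For \<open>v = ?e\<close> this holds even if \<open>?e = ?d\<close>,
              since \<open>x\<close> is not in the list of \<open>?e\<close>.\<close>
            have "L' v = L v" using that x by (auto simp: L'_def)
            then have "2 \<le> card ({\<tau> v, \<sigma> v} \<inter> W)" using le[OF that(1)] L[OF WC(1)[OF that(1)]] by simp
            moreover have "card {\<tau> v, \<sigma> v} \<le> 2" by (simp add: card_insert_if)
            ultimately have "card {\<tau> v, \<sigma> v} \<le> card ({\<tau> v, \<sigma> v} \<inter> W)" by linarith
            then have "{\<tau> v, \<sigma> v} \<inter> W = {\<tau> v, \<sigma> v}"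
              by (intro card_seteq) auto
            then show ?thesis by blast
          qed
          have eW: "?e \<notin> W" using cl[of ?e] e WC(2) by auto
          show False
          proof (cases "?d \<in> W")
            case False
            then have "\<And>v. v \<in> W \<Longrightarrow> \<tau> v \<in> W \<and> \<sigma> v \<in> W" using cl by metis
            moreover have "W \<subseteq> C" "W \<noteq> C" using less.prems diff(1) by auto
            ultimately show False using diff(3)[of W] \<open>W \<noteq> {}\<close> by blast
          next
            case True
            \<comment> \<open>The list of \<open>?d\<close> may have lost \<open>x\<close>, so only
              one conflict inside \<open>W\<close> is guaranteed there. It must be with
              \<open>\<tau> ?d\<close>, because \<open>\<sigma> ?d = c\<close> lies outside
              \<open>W\<close>.\<close>
            have "1 \<le> card (L' ?d)"
              using L[OF d(1)] finL[OF d(1)] by (simp add: L'_def card_Diff_singleton_if)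
            then have "1 \<le> card ({\<tau> ?d, \<sigma> ?d} \<inter> W)" using le[OF True] by linarith
            then have "{\<tau> ?d, \<sigma> ?d} \<inter> W \<noteq> {}" by (metis card.empty not_one_le_zero)
            then have "\<tau> ?d \<in> W" using d WC(2) by auto
            then have "\<And>v. v \<in> W \<Longrightarrow> \<tau> v \<in> W" using cl by metis
            then have "even (card W)"
              using even_card_involution[of W \<tau>] tau WC(1) less.prems(1) by blast
            moreover have "\<sigma> v \<in> W - {?d}" if "v \<in> W - {?d}" for v
              using cl[of v] that sig[OF WC(1), of v] WC(2)[of v] d by auto
            then have "even (card (W - {?d}))"
              using even_card_involution[of "W - {?d}" \<sigma>] sig WC(1) less.prems(1) by blast
            moreover have "card W = Suc (card (W - {?d}))"
              using True less.prems(1) by (metis card.remove)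
            ultimately show False by simp
          qed
        qed
        then obtain v where v: "v \<in> W" "card ({\<tau> v, \<sigma> v} \<inter> W) < card (L' v)" by blast
        have "card (W - {v}) < card W" using v less.prems(1) by (metis card_Diff1_less)
        then have "\<exists>f. \<forall>u\<in>W - {v}. f u \<in> L' u \<and> (\<forall>w\<in>W - {v}. w = \<tau> u \<or> w = \<sigma> u \<longrightarrow> f w \<noteq> f u)"
          using less.hyps[of "W - {v}"] less.prems by blast
        then obtain f where f: "\<forall>u\<in>W - {v}. f u \<in> L' u \<and> (\<forall>w\<in>W - {v}. w = \<tau> u \<or> w = \<sigma> u \<longrightarrow> f w \<noteq> f u)" ..
        have "card (f ` ({\<tau> v, \<sigma> v} \<inter> W)) < card (L' v)"
          using v(2) card_image_le[of "{\<tau> v, \<sigma> v} \<inter> W" f] by simp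
        then have "\<not> L' v \<subseteq> f ` ({\<tau> v, \<sigma> v} \<inter> W)"
          using card_mono[of "f ` ({\<tau> v, \<sigma> v} \<inter> W)" "L' v"] by fastforce
        then obtain y where y: "y \<in> L' v" "y \<notin> f ` ({\<tau> v, \<sigma> v} \<inter> W)" by blast
        have sym: "w \<in> {\<tau> u, \<sigma> u} \<Longrightarrow> u \<in> {\<tau> w, \<sigma> w}" if "u \<in> W" for u w
          using tau[OF WC(1)[OF that]] sig[OF WC(1)[OF that]] by auto
        have "\<tau> v \<noteq> v" "\<sigma> v \<noteq> v" using tau sig WC(1)[OF v(1)] by auto
        then have nv: "w \<noteq> v" if "w = \<tau> v \<or> w = \<sigma> v" for w using that by auto
        have "(f(v := y)) u \<in> L' u \<and> (\<forall>w\<in>W. w = \<tau> u \<or> w = \<sigma> u \<longrightarrow> (f(v := y)) w \<noteq> (f(v := y)) u)"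
          if u: "u \<in> W" for u
        proof (cases "u = v")
          case True
          have "f w \<noteq> y" if "w \<in> W" "w = \<tau> v \<or> w = \<sigma> v" for w using y(2) that by blast
          then show ?thesis using True y(1) nv by simp
        next
          case False
          then have fu: "f u \<in> L' u" "\<And>w. w \<in> W \<Longrightarrow> w \<noteq> v \<Longrightarrow> w = \<tau> u \<or> w = \<sigma> u \<Longrightarrow> f w \<noteq> f u"
            using f u by blast+
          have "y \<noteq> f u" if "v = \<tau> u \<or> v = \<sigma> u"
          proof -
            have "u \<in> {\<tau> v, \<sigma> v} \<inter> W" using sym[OF u, of v] that u by blast
            then show ?thesis using y(2) by blast
          qed
          then have "(f(v := y)) w \<noteq> f u" if "w \<in> W" "w = \<tau> u \<or> w = \<sigma> u" for w
            using fu(2)[OF that(1) _ that(2)] that(2) by (cases "w = v") auto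
          then show ?thesis using False fu(1) by simp
        qed
        then show ?thesis by blast
      qed
    qed
    from this[of "C - {c}"] obtain f where
      f: "\<forall>v\<in>C - {c}. f v \<in> L' v \<and> (\<forall>w\<in>C - {c}. w = \<tau> v \<or> w = \<sigma> v \<longrightarrow> f w \<noteq> f v)" by blast
    have "f ?e \<in> L' ?e" "f ?d \<in> L' ?d" using f e(1,3) d(1,3) by blast+
    then have fe: "f ?e \<noteq> x" "f ?d \<noteq> x" using x(2) unfolding L'_def by (metis DiffD1, simp)
    have inC: "\<tau> v \<in> C \<and> \<sigma> v \<in> C" if "v \<in> C" for v using tau sig that by blast
    have "(f(c := x)) v \<in> L v \<and> (f(c := x)) (\<tau> v) \<noteq> (f(c := x)) v \<and> (f(c := x)) (\<sigma> v) \<noteq> (f(c := x)) v"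
      if v: "v \<in> C" for v
    proof (cases "v = c")
      case True
      then show ?thesis using fe e d x by auto
    next
      case False
      then have "f v \<in> L v" using f v by (auto simp: L'_def)
      moreover have "(f(c := x)) (\<tau> v) \<noteq> f v"
        using f v False inC[OF v] fe tau[OF v] by (cases "\<tau> v = c") auto
      moreover have "(f(c := x)) (\<sigma> v) \<noteq> f v"
        using f v False inC[OF v] fe sig[OF v] by (cases "\<sigma> v = c") auto
      ultimately show ?thesis using False by simp
    qed
    then show ?thesis by blast
  qed
qed

text \<open>In a multigraph with at least as many edges as vertices, given by its half-edges, edges
  are deleted as long as this bound survives and an edge remains. In the end no vertex has degree 1,
  since deleting its edge would lower both counts, and there are exactly as many edges as vertices;
  hence every degree is 2.\<close>

lemma exists_two_regular:
  assumes "finite A" "A \<noteq> {}"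
    and "\<And>a. a \<in> A \<Longrightarrow> \<tau> a \<in> A \<and> \<tau> (\<tau> a) = a \<and> \<tau> a \<noteq> a"
    and "2 * card (h ` A) \<le> card A"
  shows "\<exists>C\<subseteq>A. C \<noteq> {} \<and> (\<forall>c\<in>C. \<tau> c \<in> C) \<and> (\<forall>c\<in>C. card {b \<in> C. h b = h c} = 2)"
  using assms
proof (induction "card A" arbitrary: A rule: less_induct)
  case less
  note fin = less.prems(1) and ne = less.prems(2) and tau = less.prems(3) and le = less.prems(4)
  have tau_Diff: "\<tau> b \<in> A - {a, \<tau> a}" if "a \<in> A" "b \<in> A - {a, \<tau> a}" for a b
    using that tau[of a] tau[of b] by auto
  have card_Diff: "card A = card (A - {a, \<tau> a}) + 2" if "a \<in> A" for a
    using that fin tau[OF that] card_Diff_subset[of "{a, \<tau> a}" A] card_mono[of A "{a, \<tau> a}"] by force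
  show ?case
  proof (cases "\<exists>a\<in>A. A - {a, \<tau> a} \<noteq> {} \<and> 2 * card (h ` (A - {a, \<tau> a})) \<le> card (A - {a, \<tau> a})")
    case True
    then obtain a where a: "a \<in> A" and ne': "A - {a, \<tau> a} \<noteq> {}"
      and le': "2 * card (h ` (A - {a, \<tau> a})) \<le> card (A - {a, \<tau> a})" by blast
    have "\<exists>C\<subseteq>A - {a, \<tau> a}. C \<noteq> {} \<and> (\<forall>c\<in>C. \<tau> c \<in> C) \<and> (\<forall>c\<in>C. card {b \<in> C. h b = h c} = 2)"
    proof (rule less.hyps)
      show "card (A - {a, \<tau> a}) < card A" using card_Diff[OF a] by simp
      show "finite (A - {a, \<tau> a})" using fin by simp
      show "\<tau> b \<in> A - {a, \<tau> a} \<and> \<tau> (\<tau> b) = b \<and> \<tau> b \<noteq> b" if "b \<in> A - {a, \<tau> a}" for b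
        using tau_Diff[OF a that] tau that by auto
    qed (use ne' le' in auto)
    then show ?thesis by (meson Diff_subset subset_trans)
  next
    case False
    let ?F = "\<lambda>x. {b \<in> A. h b = x}"
    have fib: "2 \<le> card (?F x)" if x: "x \<in> h ` A" for x
    proof (rule ccontr)
      assume "\<not> 2 \<le> card (?F x)"
      moreover have "card (?F x) \<noteq> 0" using x fin by auto
      ultimately have "card (?F x) = 1" by linarith
      then obtain a where a: "?F x = {a}" by (auto simp: card_1_singleton_iff)
      then have aA: "a \<in> A" "h a = x" by auto
      have "h ` (A - {a, \<tau> a}) \<subseteq> h ` A - {x}" using a by auto
      then have "card (h ` (A - {a, \<tau> a})) \<le> card (h ` A) - 1"
        using fin x by (metis card_Diff_singleton card_mono finite_Diff finite_imageI)
      moreover have "card (h ` A) \<noteq> 0" using x fin by auto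
      ultimately have "2 * card (h ` (A - {a, \<tau> a})) \<le> card (A - {a, \<tau> a})"
        using le card_Diff[OF aA(1)] by linarith
      then have "A - {a, \<tau> a} = {}" using False aA(1) by blast
      then have A: "A = {a, \<tau> a}" using aA tau by auto
      \<comment> \<open>A single edge joining two different hubs violates the bound.\<close>
      have "h (\<tau> a) \<noteq> h a" using a tau[OF aA(1)] aA by blast
      then have "card (h ` A) = 2" by (subst A) auto
      moreover have "card A = 2" using card_Diff[OF aA(1)] A by simp
      ultimately show False using le by simp
    qed
    have "card A \<le> 2 * card (h ` A)"
    proof (rule ccontr)
      assume "\<not> ?thesis"
      moreover have "even (card A)" using even_card_involution[OF fin] tau by blast
      \<comment> \<open>By parity the excess is at least a whole edge, so any edge could be
        deleted.\<close>
      ultimately have *: "2 * card (h ` A) + 2 \<le> card A" by presburger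
      obtain a where a: "a \<in> A" using ne by blast
      have "card (h ` (A - {a, \<tau> a})) \<le> card (h ` A)" using fin by (intro card_mono) auto
      then have "2 * card (h ` (A - {a, \<tau> a})) \<le> card (A - {a, \<tau> a})" using * card_Diff[OF a] by linarith
      then have "A - {a, \<tau> a} = {}" using False a by blast
      then have "card A = 2" using card_Diff[OF a] by (metis card.empty add_0)
      then have "card (h ` A) = 0" using * by simp
      then show False using a fin by auto
    qed
    moreover have "card A = (\<Sum>x\<in>h ` A. card (?F x))"
      using sum.group[OF fin finite_imageI[OF fin, of h], where g = h and h = "\<lambda>_. 1 :: nat"] by simp
    ultimately have "(\<Sum>x\<in>h ` A. card (?F x)) \<le> (\<Sum>x\<in>h ` A. 2)" by simp
    then have "card (?F x) = 2" if "x \<in> h ` A" for x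
      using sum_mono_inv[of "\<lambda>_. 2" "h ` A" "\<lambda>x. card (?F x)" x] fib that fin
        sum_mono[of "h ` A" "\<lambda>_. 2" "\<lambda>x. card (?F x)"] by (metis (no_types, lifting) finite_imageI le_antisym)
    then show ?thesis using ne tau by (intro exI[of _ A]) auto
  qed
qed

text \<open>
  Here \<open>A\<close> is the set of half-edges of a multigraph with hub map \<open>h\<close>, and \<open>\<tau>\<close> swaps the two halves of
  an edge. With at least as many edges as hubs the multigraph has a cycle, and the half-edges of
  a cycle conflict along an even cycle, which is 2-choosable.
\<close>

lemma half_edges_list_colorable:
  assumes "finite A" "A \<noteq> {}"
    and tau: "\<And>a. a \<in> A \<Longrightarrow> \<tau> a \<in> A \<and> \<tau> (\<tau> a) = a \<and> \<tau> a \<noteq> a"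
    and "2 * card (h ` A) \<le> card A"
  shows "\<exists>C\<subseteq>A. C \<noteq> {} \<and> (\<forall>a\<in>C. \<tau> a \<in> C) \<and> (\<forall>a\<in>C. card {b \<in> C. h b = h a} = 2) \<and>
    (\<forall>R :: 'a \<Rightarrow> 'c set. (\<forall>a\<in>C. 2 \<le> card (R a)) \<longrightarrow>
      (\<exists>f. \<forall>a\<in>C. f a \<in> R a \<and> f (\<tau> a) \<noteq> f a \<and> (\<forall>b\<in>C. h b = h a \<longrightarrow> b \<noteq> a \<longrightarrow> f b \<noteq> f a)))"
proof -
  obtain C where C: "C \<subseteq> A" "C \<noteq> {}" "\<forall>c\<in>C. \<tau> c \<in> C" "\<forall>c\<in>C. card {b \<in> C. h b = h c} = 2"
    using exists_two_regular[OF assms(1,2) tau assms(4)] by blast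
  \<comment> \<open>Every hub met by \<open>C\<close> carries two half-edges of \<open>C\<close>.
    The map \<open>\<sigma>\<close> will swap them and is the second matching next to
    \<open>\<tau>\<close>.\<close>
  have "\<exists>s. {b \<in> C. h b = h c} = {c, s} \<and> s \<noteq> c" if "c \<in> C" for c
  proof -
    have "card {b \<in> C. h b = h c} = 2" using C that by blast
    then obtain x y where xy: "{b \<in> C. h b = h c} = {x, y}" "x \<noteq> y" by (auto simp: card_2_iff)
    then have "c = x \<or> c = y" using that by blast
    then show ?thesis using xy by (metis insert_commute)
  qed
  then obtain \<sigma> where s: "\<And>c. c \<in> C \<Longrightarrow> {b \<in> C. h b = h c} = {c, \<sigma> c} \<and> \<sigma> c \<noteq> c" by metis
  have sC: "\<sigma> c \<in> C" "h (\<sigma> c) = h c" if "c \<in> C" for c using s[OF that] by blast+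
  have ss: "\<sigma> (\<sigma> c) = c" if "c \<in> C" for c
  proof -
    have "{c, \<sigma> c} = {\<sigma> c, \<sigma> (\<sigma> c)}"
      using s[OF that] s[OF sC(1)[OF that]] sC(2)[OF that] by simp
    then show ?thesis using s[OF that] by (auto simp: doubleton_eq_iff)
  qed
  have col: "\<exists>f. \<forall>a\<in>C. f a \<in> R a \<and> f (\<tau> a) \<noteq> f a \<and> (\<forall>b\<in>C. h b = h a \<longrightarrow> b \<noteq> a \<longrightarrow> f b \<noteq> f a)"
    if R: "\<And>a. a \<in> C \<Longrightarrow> 2 \<le> card (R a)" for R :: "'a \<Rightarrow> 'c set"
  proof -
    have "\<exists>S\<subseteq>R a. card S = 2" if "a \<in> C" for a
      using R[OF that] by (metis obtain_subset_with_card_n)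
    then obtain S where S: "\<And>a. a \<in> C \<Longrightarrow> S a \<subseteq> R a \<and> card (S a) = 2" by metis
    have "\<exists>f. \<forall>c\<in>C. f c \<in> S c \<and> f (\<tau> c) \<noteq> f c \<and> f (\<sigma> c) \<noteq> f c"
    proof (rule two_matchings_list_colorable)
      show "finite C" using finite_subset[OF C(1) assms(1)] .
      show "\<tau> c \<in> C \<and> \<tau> (\<tau> c) = c \<and> \<tau> c \<noteq> c" if "c \<in> C" for c using C(1,3) tau that by blast
      show "\<sigma> c \<in> C \<and> \<sigma> (\<sigma> c) = c \<and> \<sigma> c \<noteq> c" if "c \<in> C" for c using sC ss s that by blast
      show "card (S c) = 2" if "c \<in> C" for c using S that by blast
    qed
    then obtain f where f: "\<forall>c\<in>C. f c \<in> S c \<and> f (\<tau> c) \<noteq> f c \<and> f (\<sigma> c) \<noteq> f c" ..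
    have "b = \<sigma> a" if "a \<in> C" "b \<in> C" "h b = h a" "b \<noteq> a" for a b
      using s[OF that(1)] that by blast
    then have "\<forall>a\<in>C. f a \<in> R a \<and> f (\<tau> a) \<noteq> f a \<and> (\<forall>b\<in>C. h b = h a \<longrightarrow> b \<noteq> a \<longrightarrow> f b \<noteq> f a)"
      using f S by (metis subsetD)
    then show ?thesis by blast
  qed
  show ?thesis using C col by (intro exI[of _ C]) simp
qed

text \<open>The missing edge joins \<open>a\<close> and \<open>d\<close>. A colour common to
  \<open>A\<close> and \<open>D\<close> is used at both, and three colours each suffice for
  \<open>b\<close> and \<open>c\<close>. Otherwise \<open>A\<close> and \<open>D\<close> together
  have at least four colours, so one of these lies outside a 3-subset \<open>B'\<close> of
  \<open>B\<close> and costs \<open>b\<close> nothing.\<close>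

lemma K4_minus_edge_list_colorable:
  assumes "2 \<le> card A" "3 \<le> card B" "3 \<le> card C" "2 \<le> card D"
  obtains a b c d where "a \<in> A" "b \<in> B" "c \<in> C" "d \<in> D"
    "a \<noteq> b" "a \<noteq> c" "b \<noteq> c" "b \<noteq> d" "c \<noteq> d"
proof -
  have avoid: "\<exists>x\<in>X. x \<notin> Y" if "card Y < card X" "finite Y" for X Y :: "'a set"
    using that card_mono[of Y X] by fastforce
  have avoid2: "\<exists>z\<in>X. z \<noteq> x \<and> z \<noteq> y" if "3 \<le> card X" for X and x y :: 'a
  proof -
    have "card {x, y} \<le> 2" by (cases "x = y") auto
    then show ?thesis using avoid[of "{x, y}" X] that by fastforce
  qed
  have fin: "finite A" "finite D" using assms card.infinite by fastforce+
  have ne: "A \<noteq> {}" "D \<noteq> {}" using assms(1,4) by auto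
  obtain B' where B': "B' \<subseteq> B" "card B' = 3" using assms(2) by (metis obtain_subset_with_card_n)
  \<comment> \<open>The colour \<open>x\<close> is used at one of the two nonadjacent vertices and
    \<open>y\<close> at the other. Then \<open>c\<close> is chosen from \<open>C\<close>, and
    finally \<open>b\<close> from \<open>B'\<close>, where \<open>x\<close> forbids nothing.\<close>
  have key: "\<exists>x\<in>X. \<exists>y\<in>Y. \<exists>b\<in>B. \<exists>c\<in>C. x \<noteq> b \<and> x \<noteq> c \<and> b \<noteq> c \<and> b \<noteq> y \<and> c \<noteq> y"
    if x: "x \<in> X" "x \<notin> B'" and y: "y \<in> Y" for x y X Y
  proof -
    obtain c where c: "c \<in> C" "c \<noteq> x" "c \<noteq> y" using avoid2[OF assms(3)] by metis
    obtain b where b: "b \<in> B'" "b \<noteq> c" "b \<noteq> y" using avoid2[of B'] B' by (metis order_refl)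
    show ?thesis
      using x y c b B'(1) by (intro bexI[of _ x] bexI[of _ y] bexI[of _ b] bexI[of _ c]) auto
  qed
  show ?thesis
  proof (cases "A \<inter> D = {}")
    case True
    then have "card B' < card (A \<union> D)" using assms fin B' by (simp add: card_Un_disjoint)
    moreover have "finite B'" using B' card.infinite by fastforce
    ultimately obtain x where x: "x \<in> A \<union> D" "x \<notin> B'" using avoid by blast
    then consider "x \<in> A" | "x \<in> D" by blast
    then show ?thesis
    proof cases
      case 1
      obtain y where "y \<in> D" using ne by blast
      then show ?thesis using key[OF 1 x(2)] that by metis
    next
      case 2
      obtain y where "y \<in> A" using ne by blast
      then show ?thesis using key[OF 2 x(2)] that by metis
    qed
  next
    case False
    then obtain a where a: "a \<in> A" "a \<in> D" by blast
    obtain b where b: "b \<in> B" "b \<noteq> a" using avoid2[OF assms(2)] by metis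
    obtain c where "c \<in> C" "c \<noteq> a" "c \<noteq> b" using avoid2[OF assms(3)] by metis
    then show ?thesis using that[of a b c a] a b by simp
  qed
qed

subsection \<open>Reducible configurations\<close>

definition square_nbrs :: "('a \<times> 'a) set \<Rightarrow> 'a \<Rightarrow> 'a set" where
  "square_nbrs E v = {w. w \<noteq> v \<and> ((v, w) \<in> E \<or> (\<exists>p. (v, p) \<in> E \<and> (p, w) \<in> E))}"

text \<open>\<open>E\<close> is not restricted to \<open>W\<close>: coloured vertices conflict also
  through a common neighbour outside \<open>W\<close>, as they must if a partial colouring is to be
  extended.\<close>

definition square_coloring ::
    "('a \<times> 'a) set \<Rightarrow> ('a \<Rightarrow> 'c set) \<Rightarrow> 'a set \<Rightarrow> ('a \<Rightarrow> 'c) \<Rightarrow> bool" where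
  "square_coloring E L W c \<longleftrightarrow>
     (\<forall>v\<in>W. c v \<in> L v \<and> (\<forall>u\<in>W \<inter> square_nbrs E v. c u \<noteq> c v))"

text \<open>The set \<open>X\<close> consists of neighbours that are still uncoloured when \<open>v\<close> is coloured.\<close>

primrec greedy_order :: "('a \<Rightarrow> 'a set) \<Rightarrow> 'a list \<Rightarrow> bool" where
  "greedy_order M [] \<longleftrightarrow> True"
| "greedy_order M (v # vs) \<longleftrightarrow>
     (\<exists>X\<subseteq>M v \<inter> set vs. card (M v) \<le> 5 + card X) \<and> greedy_order M vs"

lemma greedy_order_ConsI:
  "\<lbrakk>greedy_order M vs; X \<subseteq> M v \<inter> set vs; card (M v) \<le> 5 + card X\<rbrakk> \<Longrightarrow> greedy_order M (v # vs)"
  by auto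

text \<open>A counterexample that is minimal under deleting vertices and edges, with the lists
  \<open>L\<close> fixed. \<open>E\<close> contains both orientations of every edge. The density
  bound enters only afterwards: \<open>card_E_ge\<close> shows that every such graph is too
  dense.\<close>

locale critical =
  fixes V :: "'a set" and E :: "('a \<times> 'a) set" and L :: "'a \<Rightarrow> 'c set"
  assumes finite_V: "finite V"
    and E_sub: "E \<subseteq> V \<times> V"
    and sym: "(u, v) \<in> E \<Longrightarrow> (v, u) \<in> E"
    and irrefl: "(v, v) \<notin> E"
    and deg_le: "v \<in> V \<Longrightarrow> card (E `` {v}) \<le> 5"
    and lists: "v \<in> V \<Longrightarrow> finite (L v) \<and> 6 \<le> card (L v)"
    and not_colorable: "\<not> square_coloring E L V c"
    and minimal: "\<lbrakk>V' \<subseteq> V; E' \<subseteq> E; E' \<subseteq> V' \<times> V'; \<And>u v. (u, v) \<in> E' \<Longrightarrow> (v, u) \<in> E';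
      V' \<noteq> V \<or> E' \<noteq> E\<rbrakk> \<Longrightarrow> \<exists>c. square_coloring E' L V' c"
begin

section \<open>Degrees in the graph and in its square, and greedy extension\<close>

definition N :: "'a \<Rightarrow> 'a set" where "N v = E `` {v}"
abbreviation d :: "'a \<Rightarrow> nat" where "d v \<equiv> card (N v)"
abbreviation N2 :: "'a \<Rightarrow> 'a set" where "N2 \<equiv> square_nbrs E"

definition D :: "'a \<Rightarrow> nat" where "D v = (\<Sum>p\<in>N v. d p)"

lemma N_iff: "v \<in> N u \<longleftrightarrow> (u, v) \<in> E" by (simp add: N_def)
lemma N_sub: "N v \<subseteq> V" using E_sub by (auto simp: N_iff)
lemma d_le: "v \<in> V \<Longrightarrow> d v \<le> 5" using deg_le by (simp add: N_def)
lemma finite_N [simp]: "finite (N v)" using finite_subset[OF N_sub finite_V] .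
lemma N_sym: "u \<in> N v \<longleftrightarrow> v \<in> N u" using sym by (auto simp: N_iff)
lemma N_irrefl: "v \<notin> N v" using irrefl by (simp add: N_iff)
lemma N2_sub: "N2 v \<subseteq> V" using E_sub by (auto simp: square_nbrs_def)
lemma finite_N2 [simp]: "finite (N2 v)" using finite_subset[OF N2_sub finite_V] .
lemma N2_sym: "u \<in> N2 v \<longleftrightarrow> v \<in> N2 u" using sym unfolding square_nbrs_def by blast
lemma N_N2: "u \<in> N v \<Longrightarrow> u \<in> N2 v" using N_irrefl[of v] by (auto simp: square_nbrs_def N_iff)
lemma NN_N2: "p \<in> N v \<Longrightarrow> u \<in> N p \<Longrightarrow> u \<noteq> v \<Longrightarrow> u \<in> N2 v"
  by (auto simp: square_nbrs_def N_iff)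

lemma d_pos: "u \<in> N v \<Longrightarrow> 0 < d v"
  by (auto simp: card_gt_0_iff)

text \<open>Each neighbour \<open>p\<close> of \<open>v\<close> contributes itself and its
  \<open>d p - 1\<close> neighbours other than \<open>v\<close>.\<close>

lemma card_N2_le: "card (N2 v) \<le> D v"
proof -
  have "N2 v \<subseteq> (\<Union>p\<in>N v. insert p (N p - {v}))" by (auto simp: square_nbrs_def N_iff)
  then have "card (N2 v) \<le> card (\<Union>p\<in>N v. insert p (N p - {v}))" by (intro card_mono) auto
  also have "\<dots> \<le> (\<Sum>p\<in>N v. card (insert p (N p - {v})))" by (intro card_UN_le) auto
  also have "\<dots> \<le> D v" unfolding D_def
  proof (rule sum_mono)
    fix p assume p: "p \<in> N v"
    then have "v \<in> N p" using N_sym by blast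
    then have "card (N p - {v}) = d p - 1" "0 < d p" using d_pos by simp_all
    then show "card (insert p (N p - {v})) \<le> d p"
      using card_insert_le_m1[of "d p" "N p - {v}" p] by simp
  qed
  finally show ?thesis .
qed

text \<open>Minimality is applied to the graph without the edge \<open>uv\<close>. A path of length
  at most 2 through this edge has an end in \<open>{u, v}\<close>, hence in \<open>S\<close>, so the
  conflicts outside \<open>S\<close> do not change.\<close>

lemma partial_coloring:
  assumes "u \<in> S" "v \<in> S" "(u, v) \<in> E"
  obtains c where "square_coloring E L (V - S) c"
proof -
  let ?E = "E - {(u, v), (v, u)}"
  have "\<exists>c. square_coloring ?E L V c"
    using assms(3) E_sub sym by (intro minimal) auto
  then obtain c where c: "square_coloring ?E L V c" ..
  have "b \<in> square_nbrs ?E a" if "a \<notin> S" "b \<notin> S" "b \<in> N2 a" for a b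
    using that assms(1,2) by (auto simp: square_nbrs_def)
  then have "square_coloring E L (V - S) c"
    using c unfolding square_coloring_def by blast
  then show ?thesis using that by blast
qed

lemma extend_one:
  assumes c: "square_coloring E L W c" and v: "v \<in> V" "v \<notin> W" and le: "card (N2 v \<inter> W) \<le> 5"
  obtains x where "square_coloring E L (insert v W) (c(v := x))"
proof -
  have "card (c ` (N2 v \<inter> W)) < card (L v)"
    using card_image_le[of "N2 v \<inter> W" c] le lists[OF v(1)] by simp
  then have "\<not> L v \<subseteq> c ` (N2 v \<inter> W)"
    using card_mono[of "c ` (N2 v \<inter> W)" "L v"] by fastforce
  then obtain x where x: "x \<in> L v" "x \<notin> c ` (N2 v \<inter> W)" by blast
  have *: "v \<notin> N2 v" by (simp add: square_nbrs_def)
  have "square_coloring E L (insert v W) (c(v := x))"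
    unfolding square_coloring_def
  proof (intro ballI conjI)
    fix a assume a: "a \<in> insert v W"
    then show "(c(v := x)) a \<in> L a" using x(1) c by (auto simp: square_coloring_def)
    fix b assume b: "b \<in> insert v W \<inter> N2 a"
    consider "a = v" "b \<in> W" | "a \<in> W" "a \<noteq> v" "b = v" | "a \<in> W" "a \<noteq> v" "b \<in> W" "b \<noteq> v"
      using a b * by blast
    then show "(c(v := x)) b \<noteq> (c(v := x)) a"
    proof cases
      case 1
      then show ?thesis using b x(2) * by auto
    next
      case 2
      then have "a \<in> N2 v \<inter> W" using b N2_sym by blast
      then show ?thesis using 2 x(2) by auto
    next
      case 3
      then show ?thesis using b c by (auto simp: square_coloring_def)
    qed
  qed
  then show ?thesis using that by blast
qed

lemma extend_low:
  assumes "finite U" "square_coloring E L W c" "U \<subseteq> V" "\<And>v. v \<in> U \<Longrightarrow> card (N2 v) \<le> 5"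
  shows "\<exists>c. square_coloring E L (U \<union> W) c"
  using assms
proof (induction U rule: finite_induct)
  case empty
  then show ?case by auto
next
  case (insert v U)
  then obtain c where c: "square_coloring E L (U \<union> W) c" by auto
  show ?case
  proof (cases "v \<in> W")
    case True
    then show ?thesis using c by (intro exI[of _ c]) (simp add: insert_absorb)
  next
    case False
    have "card (N2 v \<inter> (U \<union> W)) \<le> card (N2 v)" by (intro card_mono) auto
    then have "card (N2 v \<inter> (U \<union> W)) \<le> 5" using insert.prems(3)[of v] by simp
    then show ?thesis
      using extend_one[OF c, of v] insert.hyps insert.prems False by (metis Un_iff Un_insert_left insert_subset)
  qed
qed

text \<open>The edge \<open>uv\<close> inside the list yields a colouring of everything outside it.
  The listed vertices are then coloured in order: when one is reached, its set \<open>X\<close> is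
  still uncoloured, so at most five of its at least six colours are forbidden.\<close>

lemma no_greedy_order:
  assumes "distinct vs" "set vs \<subseteq> V" "u \<in> set vs" "v \<in> set vs" "(u, v) \<in> E"
  shows "\<not> greedy_order N2 vs"
proof
  assume "greedy_order N2 vs"
  moreover obtain c where "square_coloring E L (V - set vs) c"
    using partial_coloring assms(3-5) by metis
  ultimately have "\<exists>c. square_coloring E L V c"
    using assms(1,2)
  proof (induction vs arbitrary: c)
    case Nil
    then show ?case by auto
  next
    case (Cons v vs)
    obtain X where X: "X \<subseteq> N2 v \<inter> set vs" "card (N2 v) \<le> 5 + card X" using Cons.prems(1) by auto
    have fX: "finite X" using X(1) finite_subset by blast
    have "N2 v \<inter> (V - set (v # vs)) \<subseteq> N2 v - X" using X(1) by auto
    then have "card (N2 v \<inter> (V - set (v # vs))) \<le> card (N2 v - X)" by (intro card_mono) auto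
    also have "\<dots> = card (N2 v) - card X" using X(1) fX by (intro card_Diff_subset) auto
    finally have "card (N2 v \<inter> (V - set (v # vs))) \<le> 5" using X(2) by simp
    moreover have "v \<in> V" "v \<notin> V - set (v # vs)" using Cons.prems by auto
    ultimately obtain x where "square_coloring E L (insert v (V - set (v # vs))) (c(v := x))"
      using extend_one[OF Cons.prems(2)] by blast
    moreover have "insert v (V - set (v # vs)) = V - set vs" using Cons.prems by auto
    ultimately have "square_coloring E L (V - set vs) (c(v := x))" by metis
    moreover have "greedy_order N2 vs" "distinct vs" "set vs \<subseteq> V" using Cons.prems(1,3,4) by auto
    ultimately show ?case using Cons.IH by blast
  qed
  then show False using not_colorable by blast
qed

text \<open>\<open>u\<close> is coloured while its neighbour \<open>v\<close> is still uncoloured,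
  and \<open>v\<close> comes last.\<close>

lemma light_pair:
  assumes "u \<in> N v" "card (N2 u) \<le> 6" "card (N2 v) \<le> 5"
  shows False
proof -
  have "greedy_order N2 [u, v]"
    using assms N_N2[of v u] N_sym[of u v] by (auto intro!: exI[of _ "{v}"])
  moreover have "u \<in> V" "v \<in> V" "u \<noteq> v" "(u, v) \<in> E"
    using assms(1) E_sub irrefl sym by (auto simp: N_iff)
  ultimately show False using no_greedy_order[of "[u, v]" u v] by auto
qed

text \<open>A vertex with at most one neighbour is the middle of no path of length 2, so deleting it
  keeps all conflicts among the others. Its only neighbour, if any, has degree at most 5, so it can
  be coloured last.\<close>

lemma deg_ge_2:
  assumes v: "v \<in> V"
  shows "2 \<le> d v"
proof (rule ccontr)
  assume "\<not> 2 \<le> d v"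
  then have dv: "d v \<le> 1" by simp
  let ?V = "V - {v}"
  have "\<exists>c. square_coloring (E \<inter> ?V \<times> ?V) L ?V c"
    using v sym by (intro minimal) auto
  then obtain c where c: "square_coloring (E \<inter> ?V \<times> ?V) L ?V c" ..
  have "a = b" if "a \<in> N v" "b \<in> N v" for a b
    using dv that card_mono[of "N v" "{a, b}"] by (auto simp: card_insert_if split: if_splits)
  then have "b \<in> square_nbrs (E \<inter> ?V \<times> ?V) a" if "a \<in> ?V" "b \<in> ?V" "b \<in> N2 a" for a b
    using that sym E_sub unfolding square_nbrs_def N_iff by blast
  then have "square_coloring E L ?V c" using c unfolding square_coloring_def by blast
  moreover have "card (N2 v \<inter> ?V) \<le> 5"
  proof -
    have "card (N2 v \<inter> ?V) \<le> card (N2 v)" by (intro card_mono) auto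
    also have "\<dots> \<le> D v" by (rule card_N2_le)
    also have "\<dots> \<le> (\<Sum>p\<in>N v. 5)" unfolding D_def using d_le N_sub by (intro sum_mono) blast
    also have "\<dots> \<le> 5" using dv by simp
    finally show ?thesis .
  qed
  ultimately obtain x where "square_coloring E L (insert v ?V) (c(v := x))"
    using extend_one[of ?V c v] v by blast
  then show False using not_colorable v by (simp add: insert_absorb)
qed

section \<open>Cycles of threads, coloured from residual lists\<close>

lemma combine_colorings:
  assumes c: "square_coloring E L (V - S) c" and "C \<subseteq> S"
    and f: "\<And>v. v \<in> C \<Longrightarrow> f v \<in> L v - c ` (N2 v - S)"
    and ff: "\<And>u v. u \<in> C \<Longrightarrow> v \<in> C \<Longrightarrow> u \<in> N2 v \<Longrightarrow> f u \<noteq> f v"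
  shows "square_coloring E L (C \<union> (V - S)) (\<lambda>x. if x \<in> C then f x else c x)"
    (is "square_coloring E L _ ?g")
  unfolding square_coloring_def
proof (intro ballI conjI)
  fix a assume a: "a \<in> C \<union> (V - S)"
  then show "?g a \<in> L a" using f c by (auto simp: square_coloring_def)
  fix b assume b: "b \<in> (C \<union> (V - S)) \<inter> N2 a"
  consider "a \<in> C" "b \<in> C" | "a \<in> C" "b \<in> V - S" | "a \<in> V - S" "b \<in> C" | "a \<in> V - S" "b \<in> V - S"
    using a b by blast
  then show "?g b \<noteq> ?g a"
  proof cases
    case 1
    then show ?thesis using ff[of b a] b by simp
  next
    case 2
    then have "f a \<notin> c ` (N2 a - S)" "c b \<in> c ` (N2 a - S)" "b \<notin> C" using f b assms(2) by auto
    then show ?thesis using 2 by auto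
  next
    case 3
    then have "f b \<notin> c ` (N2 b - S)" "c a \<in> c ` (N2 b - S)" "a \<notin> C"
      using f b assms(2) N2_sym[of b a] by auto
    then show ?thesis using 3 by auto
  next
    case 4
    then have "a \<notin> C" "b \<notin> C" "c b \<noteq> c a" using c b assms(2) by (auto simp: square_coloring_def)
    then show ?thesis by simp
  qed
qed

lemma card_residual_list:
  assumes "v \<in> V" "card (N2 v - S) \<le> k"
  shows "6 - k \<le> card (L v - c ` (N2 v - S))"
proof -
  have "card (c ` (N2 v - S)) \<le> k" using card_image_le[of "N2 v - S" c] assms(2) by simp
  moreover have "card (L v) - card (c ` (N2 v - S)) \<le> card (L v - c ` (N2 v - S))"
    by (intro diff_card_le_card_Diff) auto
  moreover have "6 \<le> card (L v)" using lists assms(1) by blast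
  ultimately show ?thesis by linarith
qed

text \<open>The common argument for 3-threads and 2-threads. Here \<open>a\<close> is an end vertex
  of a thread, \<open>h a\<close> the hub it hangs on, \<open>\<tau> a\<close> the other end vertex
  and \<open>m a\<close> the next vertex on the thread, which is \<open>\<tau> a\<close> itself in a
  2-thread. With too many threads some of them form cycles; these are uncoloured, their end vertices
  are recoloured along even cycles, and the middle vertices are coloured last.\<close>

lemma few_half_edges:
  assumes A: "A \<subseteq> V"
    and tau: "\<And>a. a \<in> A \<Longrightarrow> \<tau> a \<in> A \<and> \<tau> (\<tau> a) = a \<and> \<tau> a \<noteq> a"
    and m: "\<And>a. a \<in> A \<Longrightarrow> m a \<in> N a"
    and m_cases: "\<And>a. a \<in> A \<Longrightarrow> m a = \<tau> a \<or> m a \<notin> A \<and> card (N2 (m a)) \<le> 5"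
    and h: "\<And>a. a \<in> A \<Longrightarrow> a \<in> N (h a) \<and> h a \<notin> A"
    and fibre: "\<And>a b. a \<in> A \<Longrightarrow> b \<in> A \<Longrightarrow> b \<in> N (h a) \<Longrightarrow> h b = h a"
    and X: "\<And>a. a \<in> A \<Longrightarrow> X a \<inter> A = {} \<and> finite (X a) \<and> d (h a) + card (X a) \<le> 5"
    and N2A: "\<And>a. a \<in> A \<Longrightarrow> N2 a \<subseteq> {h a, m a, \<tau> a} \<union> N (h a) \<union> X a"
  shows "card A \<le> 2 * card (h ` A)"
proof (rule ccontr)
  assume "\<not> ?thesis"
  then have "A \<noteq> {}" "2 * card (h ` A) \<le> card A" by auto
  then have "\<exists>C\<subseteq>A. C \<noteq> {} \<and> (\<forall>a\<in>C. \<tau> a \<in> C) \<and> (\<forall>a\<in>C. card {b \<in> C. h b = h a} = 2) \<and>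
    (\<forall>R :: 'a \<Rightarrow> 'c set. (\<forall>a\<in>C. 2 \<le> card (R a)) \<longrightarrow>
      (\<exists>f. \<forall>a\<in>C. f a \<in> R a \<and> f (\<tau> a) \<noteq> f a \<and> (\<forall>b\<in>C. h b = h a \<longrightarrow> b \<noteq> a \<longrightarrow> f b \<noteq> f a)))"
    using finite_subset[OF A finite_V] tau by (intro half_edges_list_colorable)
  then obtain C where C: "C \<subseteq> A" "C \<noteq> {}" "\<forall>a\<in>C. \<tau> a \<in> C" "\<forall>a\<in>C. card {b \<in> C. h b = h a} = 2"
    and col: "\<forall>R :: 'a \<Rightarrow> 'c set. (\<forall>a\<in>C. 2 \<le> card (R a)) \<longrightarrow>
      (\<exists>f. \<forall>a\<in>C. f a \<in> R a \<and> f (\<tau> a) \<noteq> f a \<and> (\<forall>b\<in>C. h b = h a \<longrightarrow> b \<noteq> a \<longrightarrow> f b \<noteq> f a))"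
    by (elim exE conjE)
  define S where "S = C \<union> m ` C"
  obtain a0 where a0: "a0 \<in> C" using C(2) by blast
  have "(a0, m a0) \<in> E" using m C(1) a0 N_iff by blast
  then obtain c where c: "square_coloring E L (V - S) c"
    using partial_coloring[of a0 S "m a0"] a0 by (auto simp: S_def)
  \<comment> \<open>These lists depend on the colouring \<open>c\<close>, which is obtained only
    after \<open>C\<close> is known; hence \<open>C\<close> had to work for all lists at
    once.\<close>
  define R where "R a = L a - c ` (N2 a - S)" for a
  have R: "2 \<le> card (R a)" if a: "a \<in> C" for a
  proof -
    have aA: "a \<in> A" using a C(1) by blast
    let ?F = "{b \<in> C. h b = h a}"
    have F: "?F \<subseteq> N (h a)" "?F \<subseteq> S" using h C(1) by (force simp: S_def)+
    \<comment> \<open>Coloured square neighbours of \<open>a\<close> are the hub, at most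
      \<open>d (h a) - 2\<close> other neighbours of the hub, and \<open>X a\<close>: at most 4 in
      total, so two colours remain.\<close>
    have "N2 a - S \<subseteq> insert (h a) ((N (h a) - ?F) \<union> X a)"
      using N2A[OF aA] F a C(3) by (auto simp: S_def)
    then have "card (N2 a - S) \<le> card (insert (h a) ((N (h a) - ?F) \<union> X a))"
      using X[OF aA] by (intro card_mono) auto
    also have "\<dots> \<le> Suc (card ((N (h a) - ?F) \<union> X a))" by (rule card_insert_le_m1[simplified]) auto
    also have "\<dots> \<le> Suc (card (N (h a) - ?F) + card (X a))" using card_Un_le by auto
    also have "card (N (h a) - ?F) = d (h a) - 2"
      using card_Diff_subset[of ?F "N (h a)"] F(1) C(4) a finite_subset[OF F(1)] by simp
    also have "Suc (d (h a) - 2 + card (X a)) \<le> 4"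
      using X[OF aA] card_mono[OF finite_N F(1)] C(4) a by auto
    finally have "card (N2 a - S) \<le> 4" .
    then show ?thesis using card_residual_list[of a S 4 c] aA A unfolding R_def by auto
  qed
  obtain f where f: "\<forall>a\<in>C. f a \<in> R a \<and> f (\<tau> a) \<noteq> f a \<and> (\<forall>b\<in>C. h b = h a \<longrightarrow> b \<noteq> a \<longrightarrow> f b \<noteq> f a)"
    using col R by blast
  have CS: "C \<subseteq> S" by (auto simp: S_def)
  have "f b \<noteq> f a" if ab: "b \<in> C" "a \<in> C" "b \<in> N2 a" for a b
  proof -
    have aA: "a \<in> A" "b \<in> A" using C(1) ab by auto
    have "b \<noteq> a" using ab(3) by (auto simp: square_nbrs_def)
    have "b \<in> {h a, m a, \<tau> a} \<union> N (h a) \<union> X a" using N2A[OF aA(1)] ab(3) by blast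
    \<comment> \<open>All other square neighbours of \<open>a\<close> lie outside \<open>A\<close>.
      So the conflicts inside \<open>C\<close> are just those between partners and between vertices
      at the same hub.\<close>
    then consider "b = \<tau> a" | "b \<in> N (h a)" using X[OF aA(1)] h[OF aA(1)] m_cases[OF aA(1)] aA(2) by blast
    then show "f b \<noteq> f a"
    proof cases
      case 1
      then show ?thesis using f ab(2) by blast
    next
      case 2
      then show ?thesis using fibre[OF aA] f ab(1,2) \<open>b \<noteq> a\<close> by blast
    qed
  qed
  moreover have "f v \<in> L v - c ` (N2 v - S)" if "v \<in> C" for v using f that by (simp add: R_def)
  ultimately have colC: "square_coloring E L (C \<union> (V - S)) (\<lambda>x. if x \<in> C then f x else c x)"
    by (intro combine_colorings c CS)
  have "m a \<in> V" if "a \<in> C" for a using subsetD[OF N_sub m[of a]] C(1) that by blast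
  then have mCV: "m ` C \<subseteq> V" by blast
  have "card (N2 (m a)) \<le> 5" if "a \<in> C" "m a \<notin> C" for a
  proof -
    have "m a \<noteq> \<tau> a" using C(3) that by metis
    then show ?thesis using m_cases[of a] that(1) C(1) by blast
  qed
  then have low: "card (N2 v) \<le> 5" if "v \<in> m ` C - C" for v using that by blast
  have "finite (m ` C - C)" "m ` C - C \<subseteq> V" using finite_subset[OF mCV finite_V] mCV by auto
  then have "\<exists>c. square_coloring E L ((m ` C - C) \<union> (C \<union> (V - S))) c"
    using extend_low[OF _ colC] low by metis
  moreover have "(m ` C - C) \<union> (C \<union> (V - S)) = V"
    using C(1) A mCV by (auto simp: S_def)
  ultimately show False using not_colorable by metis
qed

lemma two_nbrs:
  assumes "d v = 2" "p \<in> N v"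
  obtains q where "N v = {p, q}" "p \<noteq> q" "D v = d p + d q"
proof -
  obtain x y where xy: "N v = {x, y}" "x \<noteq> y" using assms(1) by (auto simp: card_2_iff)
  then have "\<exists>q. N v = {p, q} \<and> p \<noteq> q" using assms(2) by (metis insertE insert_commute singletonD)
  then obtain q where "N v = {p, q}" "p \<noteq> q" by blast
  then show ?thesis using that by (simp add: D_def)
qed

text \<open>
  \<open>A5\<close> consists of the end vertices of 3-threads, and \<open>A4\<close> of the vertices of 2-threads between
  two 4-vertices. That a 3-thread ends in two 5-vertices is part of the proof of \<open>card_A5\<close>.
\<close>

definition A5 :: "'a set" where
  "A5 = {v \<in> V. d v = 2 \<and> D v = 7 \<and> (\<exists>p\<in>N v. d p = 2 \<and> D p = 4)}"

definition A4 :: "'a set" where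
  "A4 = {v \<in> V. d v = 2 \<and> D v = 6 \<and> (\<exists>p\<in>N v. d p = 2 \<and> D p = 6)}"

lemma N2_two_nbrs: "N v = {p, q} \<Longrightarrow> N2 v \<subseteq> {p, q} \<union> (N p - {v}) \<union> (N q - {v})"
  unfolding square_nbrs_def N_iff[symmetric] by auto

text \<open>\<open>m a\<close> is the middle vertex of the 3-thread, \<open>\<tau> a\<close> its
  opposite end vertex and \<open>h a\<close> the adjacent 5-vertex. The set \<open>X a\<close> is
  empty, as nothing lies within distance 2 of \<open>a\<close> but these and the neighbours of the
  hub.\<close>

lemma card_A5: "card A5 \<le> 2 * card {v \<in> V. d v = 5}"
proof -
  have "\<exists>m h. N a = {m, h} \<and> d m = 2 \<and> D m = 4 \<and> d h = 5" if a: "a \<in> A5" for a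
  proof -
    obtain p where p: "p \<in> N a" "d p = 2" "D p = 4" "d a = 2" "D a = 7" using a unfolding A5_def by blast
    obtain q where "N a = {p, q}" "D a = d p + d q" using two_nbrs[OF p(4,1)] by metis
    then show ?thesis using p by auto
  qed
  then obtain m h where mh: "\<And>a. a \<in> A5 \<Longrightarrow> N a = {m a, h a} \<and> d (m a) = 2 \<and> D (m a) = 4 \<and> d (h a) = 5"
    by metis
  have "\<exists>t. N (m a) = {a, t} \<and> t \<noteq> a \<and> d t = 2" if a: "a \<in> A5" for a
  proof -
    have "a \<in> N (m a)" "d a = 2" using mh[OF a] N_sym[of a "m a"] a by (auto simp: A5_def)
    then show ?thesis using two_nbrs[of "m a" a] mh[OF a] by (metis add_left_cancel numeral_Bit0)
  qed
  then obtain \<tau> where t: "\<And>a. a \<in> A5 \<Longrightarrow> N (m a) = {a, \<tau> a} \<and> \<tau> a \<noteq> a \<and> d (\<tau> a) = 2" by metis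
  have tA: "\<tau> a \<in> A5" if a: "a \<in> A5" for a
  proof -
    have ma: "m a \<in> N (\<tau> a)" using t[OF a] N_sym[of "\<tau> a" "m a"] by blast
    obtain q where q: "N (\<tau> a) = {m a, q}" "D (\<tau> a) = 2 + d q"
      using two_nbrs[OF _ ma] t[OF a] mh[OF a] by metis
    have "q \<in> V" using q(1) N_sub by blast
    then have "D (\<tau> a) \<le> 7" using q(2) d_le by fastforce
    \<comment> \<open>If the opposite hub had degree at most 4, then \<open>\<tau> a\<close> and
      \<open>m a\<close> would be a light pair. So both hubs are 5-vertices.\<close>
    moreover have "\<not> D (\<tau> a) \<le> 6"
      using light_pair[of "\<tau> a" "m a"] card_N2_le[of "\<tau> a"] card_N2_le[of "m a"] mh[OF a] t[OF a] by auto
    moreover have "\<tau> a \<in> V" using t[OF a] N_sub by blast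
    moreover have "\<exists>p\<in>N (\<tau> a). d p = 2 \<and> D p = 4" using ma mh[OF a] by blast
    ultimately show ?thesis using t[OF a] by (simp add: A5_def)
  qed
  have mt: "m (\<tau> a) = m a" if a: "a \<in> A5" for a
  proof -
    have "m a \<in> N (\<tau> a)" using t[OF a] N_sym[of "\<tau> a" "m a"] by blast
    then show ?thesis using mh[OF a] mh[OF tA[OF a]] by force
  qed
  have tt: "\<tau> (\<tau> a) = a" if a: "a \<in> A5" for a
    using t[OF a] t[OF tA[OF a]] mt[OF a] by (metis doubleton_eq_iff)
  have dA: "d a = 2" if "a \<in> A5" for a using that by (simp add: A5_def)
  have nA: "x \<notin> A5" if "d x \<noteq> 2" for x using that dA by blast
  have "card A5 \<le> 2 * card (h ` A5)"
  proof (rule few_half_edges[of A5 \<tau> m h "\<lambda>_. {}"])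
    show "A5 \<subseteq> V" unfolding A5_def by blast
    fix a assume a: "a \<in> A5"
    show "\<tau> a \<in> A5 \<and> \<tau> (\<tau> a) = a \<and> \<tau> a \<noteq> a" using tA tt t a by blast
    show "m a \<in> N a" using mh[OF a] by blast
    have "m a \<notin> A5" using mh[OF a] by (auto simp: A5_def)
    then show "m a = \<tau> a \<or> m a \<notin> A5 \<and> card (N2 (m a)) \<le> 5"
      using mh[OF a] card_N2_le[of "m a"] by auto
    have "h a \<notin> A5" using nA mh[OF a] by simp
    moreover have "a \<in> N (h a)" using mh[OF a] N_sym[of a "h a"] by blast
    ultimately show "a \<in> N (h a) \<and> h a \<notin> A5" by blast
    show "{} \<inter> A5 = {} \<and> finite {} \<and> d (h a) + card {} \<le> 5" using mh[OF a] by simp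
    show "N2 a \<subseteq> {h a, m a, \<tau> a} \<union> N (h a) \<union> {}"
      using N2_two_nbrs[of a "m a" "h a"] mh[OF a] t[OF a] by blast
    fix b assume b: "b \<in> A5" "b \<in> N (h a)"
    then have "h a \<in> {m b, h b}" using mh[OF b(1)] N_sym[of b "h a"] by blast
    then show "h b = h a" using mh[OF a] mh[OF b(1)] by force
  qed
  also have "h ` A5 \<subseteq> {v \<in> V. d v = 5}" using mh N_sub by blast
  then have "card (h ` A5) \<le> card {v \<in> V. d v = 5}" using finite_V by (intro card_mono) auto
  finally show ?thesis by simp
qed

text \<open>In a 2-thread \<open>m a\<close> is the opposite end vertex and serves as the involution
  too. The hub has one neighbour fewer than a 5-vertex, which makes room for the far hub
  \<open>h (m a)\<close>, also a square neighbour of \<open>a\<close>.\<close>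

lemma card_A4: "card A4 \<le> 2 * card {v \<in> V. d v = 4}"
proof -
  have "\<exists>m h. N a = {m, h} \<and> d m = 2 \<and> D m = 6 \<and> d h = 4" if a: "a \<in> A4" for a
  proof -
    obtain p where p: "p \<in> N a" "d p = 2" "D p = 6" "d a = 2" "D a = 6" using a unfolding A4_def by blast
    obtain q where "N a = {p, q}" "D a = d p + d q" using two_nbrs[OF p(4,1)] by metis
    then show ?thesis using p by auto
  qed
  then obtain m h where mh: "\<And>a. a \<in> A4 \<Longrightarrow> N a = {m a, h a} \<and> d (m a) = 2 \<and> D (m a) = 6 \<and> d (h a) = 4"
    by metis
  have dA: "d a = 2" if "a \<in> A4" for a using that by (simp add: A4_def)
  have mA: "m a \<in> A4" if a: "a \<in> A4" for a
  proof -
    have "a \<in> N (m a)" using mh[OF a] N_sym[of a "m a"] by blast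
    moreover have "m a \<in> V" using mh[OF a] N_sub by blast
    moreover have "d a = 2" "D a = 6" using a by (simp_all add: A4_def)
    ultimately show ?thesis using mh[OF a] unfolding A4_def by blast
  qed
  have mm: "m (m a) = a" if a: "a \<in> A4" for a
  proof -
    have "a \<in> {m (m a), h (m a)}" using mh[OF a] mh[OF mA[OF a]] N_sym[of a "m a"] by blast
    then show ?thesis using mh[OF mA[OF a]] dA[OF a] by force
  qed
  have nA: "x \<notin> A4" if "d x \<noteq> 2" for x using that dA by blast
  have "card A4 \<le> 2 * card (h ` A4)"
  proof (rule few_half_edges[of A4 m m h "\<lambda>a. {h (m a)}"])
    show "A4 \<subseteq> V" unfolding A4_def by blast
    fix a assume a: "a \<in> A4"
    have hd: "d (h a) = 4" "d (h (m a)) = 4" using mh[OF a] mh[OF mA[OF a]] by blast+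
    have "m a \<in> N a" using mh[OF a] by blast
    then have "m a \<noteq> a" using N_irrefl by metis
    then show "m a \<in> A4 \<and> m (m a) = a \<and> m a \<noteq> a" using mA[OF a] mm[OF a] by simp
    show "m a \<in> N a" using mh[OF a] by blast
    show "m a = m a \<or> m a \<notin> A4 \<and> card (N2 (m a)) \<le> 5" by simp
    have "h a \<notin> A4" using nA hd(1) by simp
    moreover have "a \<in> N (h a)" using mh[OF a] N_sym[of a "h a"] by blast
    ultimately show "a \<in> N (h a) \<and> h a \<notin> A4" by blast
    show "{h (m a)} \<inter> A4 = {} \<and> finite {h (m a)} \<and> d (h a) + card {h (m a)} \<le> 5"
      using hd nA[of "h (m a)"] by simp
    show "N2 a \<subseteq> {h a, m a, m a} \<union> N (h a) \<union> {h (m a)}"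
    proof -
      have "N (m a) = {a, h (m a)}" using mh[OF mA[OF a]] mm[OF a] by metis
      moreover have "N2 a \<subseteq> {m a, h a} \<union> (N (m a) - {a}) \<union> (N (h a) - {a})"
        using mh[OF a] by (intro N2_two_nbrs) blast
      ultimately show ?thesis by blast
    qed
    fix b assume b: "b \<in> A4" "b \<in> N (h a)"
    then have "h a \<in> {m b, h b}" using mh[OF b(1)] N_sym[of b "h a"] by blast
    then show "h b = h a" using mh[OF a] mh[OF b(1)] by force
  qed
  also have "h ` A4 \<subseteq> {v \<in> V. d v = 4}" using mh N_sub by blast
  then have "card (h ` A4) \<le> card {v \<in> V. d v = 4}" using finite_V by (intro card_mono) auto
  finally show ?thesis by simp
qed

section \<open>Light configurations around 3-vertices\<close>

lemma light_pair_D: "u \<in> N v \<Longrightarrow> D u \<le> 6 \<Longrightarrow> D v \<le> 5 \<Longrightarrow> False"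
  using light_pair card_N2_le order_trans by metis

text \<open>The order \<open>x\<close>, \<open>p\<close>, \<open>q\<close> is greedy: both
  \<open>p\<close> and \<open>q\<close> are uncoloured when \<open>x\<close> is reached.\<close>

lemma two_very_light_nbrs:
  assumes "p \<in> N x" "q \<in> N x" "p \<noteq> q" "D x \<le> 7" "D p \<le> 5" "D q \<le> 5"
  shows False
proof -
  have "card (N2 x) \<le> 7" "card (N2 p) \<le> 5" "card (N2 q) \<le> 5" using assms card_N2_le order_trans by metis+
  moreover have "{p, q} \<subseteq> N2 x" using assms N_N2 by blast
  ultimately have "greedy_order N2 [x, p, q]"
    using assms(3) by (intro greedy_order_ConsI[where X = "{p, q}" and v = x]
      greedy_order_ConsI[where X = "{}" and v = p] greedy_order_ConsI[where X = "{}" and v = q]) auto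
  moreover have "distinct [x, p, q]" "set [x, p, q] \<subseteq> V" "(x, p) \<in> E"
    using assms N_irrefl N_sub N_sym[of p x] by (auto simp flip: N_iff)
  ultimately show False using no_greedy_order[of "[x, p, q]" x p] by auto
qed

text \<open>The path \<open>x\<close>, \<open>u\<close>, \<open>y\<close>, \<open>p\<close> is
  coloured in the order \<open>y\<close>, \<open>x\<close>, \<open>u\<close>, \<open>p\<close>. When
  \<open>u\<close> is reached, \<open>p\<close> is still uncoloured and within distance 2 of it
  through \<open>y\<close>.\<close>

lemma light_chain:
  assumes "u \<in> N x" "u \<in> N y" "p \<in> N y" "distinct [y, x, u, p]"
    "D y \<le> 7" "D x \<le> 6" "D u \<le> 6" "D p \<le> 5"
  shows False
proof -
  have "card (N2 y) \<le> 7" "card (N2 x) \<le> 6" "card (N2 u) \<le> 6" "card (N2 p) \<le> 5"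
    using assms card_N2_le order_trans by metis+
  moreover have "{x, u, p} \<subseteq> N2 y"
    using assms(1-4) N_N2 NN_N2[of u y x] N_sym[of u x] by auto
  moreover have "u \<in> N2 x" using assms N_N2 by blast
  moreover have "p \<in> N2 u" using assms(1-4) NN_N2[of y u p] N_sym[of u y] by auto
  ultimately have "greedy_order N2 [y, x, u, p]"
    using assms(4) by (intro greedy_order_ConsI[where X = "{x, u, p}" and v = y]
      greedy_order_ConsI[where X = "{u}" and v = x] greedy_order_ConsI[where X = "{p}" and v = u]
      greedy_order_ConsI[where X = "{}" and v = p]) auto
  moreover have "set [y, x, u, p] \<subseteq> V" "(x, u) \<in> E"
    using assms N_sub N_sym[of u x] N_sym[of u y] by (auto simp flip: N_iff)
  ultimately show False using no_greedy_order[of "[y, x, u, p]" x u] assms(4) by auto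
qed

text \<open>Each neighbour is a 2-vertex whose other neighbour is again a 3-vertex.\<close>

definition bad :: "'a \<Rightarrow> bool" where
  "bad v \<longleftrightarrow> d v = 3 \<and> (\<forall>u\<in>N v. d u = 2 \<and> D u = 6)"

lemma bad_D: "bad v \<Longrightarrow> D v = 6"
  by (simp add: bad_def D_def)

text \<open>With a second neighbour \<open>w\<close> of \<open>x\<close>, the vertices
  \<open>w\<close>, \<open>x\<close>, \<open>u\<close>, \<open>y\<close> have square degree at most
  6 and induce in the square a complete graph without the edge \<open>wy\<close>; their residual
  lists have sizes at least 2, 3, 3, 2. If \<open>w\<close> is also adjacent to \<open>y\<close>, a
  light pair appears instead.\<close>

lemma two_bad:
  assumes u: "u \<in> N x" "u \<in> N y" and "x \<noteq> y" and bad: "bad x" "bad y"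
  shows False
proof -
  have dx: "d x = 3" "d y = 3" using bad by (auto simp: bad_def)
  have "\<not> N x \<subseteq> {u}" using card_mono[of "{u}" "N x"] dx by auto
  then obtain w where w: "w \<in> N x" "w \<noteq> u" by blast
  have dw: "d w = 2" "D w = 6" "d u = 2" "D u = 6" using bad(1) w u by (auto simp: bad_def)
  have xw: "x \<in> N w" "x \<in> N u" "y \<in> N u" using w u N_sym by blast+
  obtain z where z: "N w = {x, z}" "x \<noteq> z" "D w = d x + d z" using two_nbrs[OF dw(1) xw(1)] by metis
  have dz: "d z = 3" using z(3) dw dx by simp
  show False
  proof (cases "w \<in> N y")
    case True
    then have "z = y" using z(1) N_sym[of w y] assms(3) by auto
    \<comment> \<open>On the 4-cycle \<open>x\<close>, \<open>u\<close>, \<open>y\<close>,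
      \<open>w\<close> the vertex \<open>u\<close> is reached from \<open>w\<close> in two ways, so
      \<open>w\<close> has at most five square neighbours.\<close>
    then have "N2 w \<subseteq> {x, y} \<union> (N x - {w}) \<union> (N y - {w})" using N2_two_nbrs z(1) by blast
    also have "\<dots> = {x, y, u} \<union> (N x - {w, u}) \<union> (N y - {w, u})" using u w(2) by blast
    finally have "card (N2 w) \<le> card ({x, y, u} \<union> (N x - {w, u}) \<union> (N y - {w, u}))" by (intro card_mono) auto
    also have "\<dots> \<le> card {x, y, u} + card (N x - {w, u}) + card (N y - {w, u})"
      by (meson card_Un_le add_le_mono1 order_trans)
    also have "card (N x - {w, u}) = 1" using w u dx by (subst card_Diff_subset) auto
    also have "card (N y - {w, u}) = 1" using True w u dx by (subst card_Diff_subset) auto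
    also have "card {x, y, u} \<le> 3" by (simp add: card_insert_if)
    finally have "card (N2 w) \<le> 5" by simp
    moreover have "card (N2 x) \<le> 6" using card_N2_le[of x] bad_D bad(1) by simp
    ultimately show False using light_pair[OF xw(1)] by blast
  next
    case False
    \<comment> \<open>A common neighbour of \<open>w\<close> and \<open>y\<close> would be
      \<open>x\<close> or \<open>z\<close>, which have degree 3, whereas the bad vertex
      \<open>y\<close> has only 2-vertices as neighbours.\<close>
    have wy: "w \<notin> N2 y"
    proof
      assume "w \<in> N2 y"
      then obtain p where p: "p \<in> N y" "w \<in> N p" using False by (auto simp: square_nbrs_def N_iff)
      then have "p \<in> {x, z}" using z(1) N_sym by blast
      then show False using p(1) bad(2) dx dz by (auto simp: bad_def)
    qed
    let ?S = "{w, x, u, y}"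
    have uw: "u \<noteq> x" "u \<noteq> y" "w \<noteq> x" "w \<noteq> y" using dw dx by auto
    obtain c where c: "square_coloring E L (V - ?S) c"
      using partial_coloring[of x ?S w] w by (auto simp: N_iff)
    have SV: "?S \<subseteq> V" using u w xw N_sub by blast
    have N2s: "{x, u} \<subseteq> N2 w" "{w, u, y} \<subseteq> N2 x" "{w, x, y} \<subseteq> N2 u" "{x, u} \<subseteq> N2 y"
      using N_N2[OF xw(1)] NN_N2[OF xw(1) u(1)] N_N2[OF w(1)] N_N2[OF u(1)] NN_N2[OF u(1) xw(3)]
        NN_N2[OF xw(2) w(1)] N_N2[OF xw(2)] N_N2[OF xw(3)] N_N2[OF u(2)] NN_N2[OF u(2) xw(2)]
        w(2) assms(3) by auto
    \<comment> \<open>A vertex with at most six square neighbours keeps at least as many colours as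
      it has square neighbours in \<open>?S\<close>.\<close>
    have res: "card X \<le> card (L v - c ` (N2 v - ?S))" if "v \<in> ?S" "X \<subseteq> N2 v" "X \<subseteq> ?S" for v X
    proof -
      have "D v \<le> 6" using that(1) bad bad_D dw by auto
      then have le: "card (N2 v) \<le> 6" using card_N2_le[of v] by simp
      have X: "finite X" "card X \<le> card (N2 v)" using finite_subset[OF that(2)] card_mono[OF _ that(2)] by auto
      have "card (N2 v - ?S) \<le> card (N2 v - X)" using that(3) by (intro card_mono) auto
      also have "\<dots> = card (N2 v) - card X" using that(2) X by (intro card_Diff_subset)
      finally have "card (N2 v - ?S) \<le> 6 - card X" using le by simp
      then show ?thesis using card_residual_list[of v ?S "6 - card X" c] that(1) SV X(2) le by auto
    qed
    obtain a b e g where ab: "a \<in> L w - c ` (N2 w - ?S)" "b \<in> L x - c ` (N2 x - ?S)"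
      "e \<in> L u - c ` (N2 u - ?S)" "g \<in> L y - c ` (N2 y - ?S)"
      and ne: "a \<noteq> b" "a \<noteq> e" "b \<noteq> e" "b \<noteq> g" "e \<noteq> g"
    proof (rule K4_minus_edge_list_colorable)
      show "2 \<le> card (L w - c ` (N2 w - ?S))" using res[OF _ N2s(1)] uw by simp
      show "3 \<le> card (L x - c ` (N2 x - ?S))" using res[OF _ N2s(2)] uw w by simp
      show "3 \<le> card (L u - c ` (N2 u - ?S))" using res[OF _ N2s(3)] uw assms(3) by simp
      show "2 \<le> card (L y - c ` (N2 y - ?S))" using res[OF _ N2s(4)] uw by simp
    qed
    define f where "f v = (if v = w then a else if v = x then b else if v = u then e else g)" for v
    have fv: "f w = a" "f x = b" "f u = e" "f y = g" using uw w(2) assms(3) by (auto simp: f_def)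
    have "f v \<in> L v - c ` (N2 v - ?S)" if "v \<in> ?S" for v using that ab fv by fastforce
    moreover have "f r \<noteq> f s" if "r \<in> ?S" "s \<in> ?S" "r \<in> N2 s" for r s
    proof -
      have "r \<noteq> s" using that(3) by (auto simp: square_nbrs_def)
      moreover have "\<not> (r = w \<and> s = y)" "\<not> (r = y \<and> s = w)" using wy that(3) N2_sym[of y w] by auto
      ultimately show ?thesis using that(1,2) ne fv by (elim insertE) (auto simp: fv)
    qed
    ultimately have "square_coloring E L (?S \<union> (V - ?S)) (\<lambda>v. if v \<in> ?S then f v else c v)"
      by (intro combine_colorings c subset_refl)
    moreover have "?S \<union> (V - ?S) = V" using SV by blast
    ultimately show False using not_colorable by metis
  qed
qed

section \<open>Discharging\<close>

text \<open>
  The vertex \<open>v\<close> sends \<open>t v u\<close> to its neighbour \<open>u\<close>. If \<open>d u = 2\<close>, then \<open>D u - d v\<close> is the degree of the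
  other neighbour of \<open>u\<close>. A bad 3-vertex would have to send 6 three times, but has only 17.
\<close>

definition t :: "'a \<Rightarrow> 'a \<Rightarrow> int" where
  "t v u = (if d v = 5 then 13 else if d v = 4 then 11
    else if d v = 3 then
      (if d u \<noteq> 2 then 0 else if D u = 5 then 11
       else if D u = 6 then (if bad v then 5 else if \<exists>w\<in>N u. w \<noteq> v \<and> bad w then 7 else 6)
       else if D u = 7 then 1 else 0)
    else if d u = 2 \<and> D v = 7 then (if D u = 4 then 6 else 1) else 0)"

lemma t_nonneg: "0 \<le> t v u"
  by (simp add: t_def)

lemma t_3_le:
  assumes "d v = 3"
  shows "t v u \<le> 11" "D u \<noteq> 5 \<Longrightarrow> t v u \<le> 7" "7 \<le> D u \<Longrightarrow> t v u \<le> 1" "d u \<noteq> 2 \<Longrightarrow> t v u = 0"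
    "bad v \<Longrightarrow> D u = 6 \<Longrightarrow> t v u \<le> 5"
    "D u \<noteq> 5 \<Longrightarrow> \<not> (D u = 6 \<and> (\<exists>w\<in>N u. w \<noteq> v \<and> bad w)) \<Longrightarrow> t v u \<le> 6"
  using assms by (auto simp: t_def)

definition gain :: "'a \<Rightarrow> int" where "gain v = (\<Sum>u\<in>N v. t u v - t v u)"

lemma gain_ge:
  assumes "\<And>u. u \<in> N v \<Longrightarrow> t v u \<le> k"
  shows "- (int (d v) * k) \<le> gain v"
proof -
  have "(\<Sum>u\<in>N v. - k) \<le> gain v"
    unfolding gain_def using assms t_nonneg by (intro sum_mono) (smt (verit))
  then show ?thesis by simp
qed

lemma d_cases:
  assumes "v \<in> V"
  shows "d v = 2 \<or> d v = 3 \<or> d v = 4 \<or> d v = 5"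
  using deg_ge_2[OF assms] d_le[OF assms] by linarith

lemma gain_remove:
  assumes "q \<in> N v" "\<And>u. u \<in> N v \<Longrightarrow> u \<noteq> q \<Longrightarrow> t v u \<le> k" "l \<le> t q v - t v q"
  shows "l - (int (d v) - 1) * k \<le> gain v"
proof -
  have "gain v = t q v - t v q + (\<Sum>u\<in>N v - {q}. t u v - t v u)"
    unfolding gain_def using assms(1) by (simp add: sum.remove)
  moreover have "(\<Sum>u\<in>N v - {q}. - k) \<le> (\<Sum>u\<in>N v - {q}. t u v - t v u)"
    using assms(2) t_nonneg by (intro sum_mono) (smt (verit) DiffD1 DiffD2 singletonI)
  moreover have "int (card (N v - {q})) = int (d v) - 1"
    using assms(1) d_pos[OF assms(1)] by simp
  ultimately show ?thesis using assms(3) by simp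
qed

text \<open>The initial charge is \<open>29 * 3 - 70 = 17\<close>. If all neighbours are 2-vertices,
  the payments are at most 5 + 5 + 5 for a bad vertex and 1 + 7 + 7 otherwise. A neighbour of degree
  at least 4 brings in 11 against two payments of at most 11. Next to a 3-vertex two payments
  remain, at most 11 + 6 or 7 + 7.\<close>

lemma gain_3:
  assumes v: "v \<in> V" "d v = 3"
  shows "- 17 \<le> gain v"
proof -
  have NV: "u \<in> V" if "u \<in> N v" for u using that N_sub by blast
  have Dge: "5 \<le> D u" if u: "u \<in> N v" "d u = 2" for u
  proof -
    have "v \<in> N u" using u(1) N_sym by blast
    then obtain q where q: "N u = {v, q}" "D u = d v + d q" using two_nbrs[OF u(2)] by metis
    then have "q \<in> V" using N_sub by blast
    then show ?thesis using q(2) v(2) deg_ge_2[of q] by simp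
  qed
  consider (two) "\<And>u. u \<in> N v \<Longrightarrow> d u = 2" | (large) q where "q \<in> N v" "4 \<le> d q"
    | (three) q where "q \<in> N v" "d q = 3" "\<And>u. u \<in> N v \<Longrightarrow> d u = 2 \<or> d u = 3"
  proof -
    have "(\<forall>u\<in>N v. d u = 2) \<or> (\<exists>q\<in>N v. 4 \<le> d q) \<or> (\<exists>q\<in>N v. d q = 3 \<and> (\<forall>u\<in>N v. d u = 2 \<or> d u = 3))"
      using d_cases NV by (metis order_refl numeral_le_iff semiring_norm(69,72,78))
    then show ?thesis using that by blast
  qed
  then show ?thesis
  proof cases
    case two
    then have "D v = 6" using v(2) by (simp add: D_def)
    then have D6: "6 \<le> D u" if "u \<in> N v" for u
      using light_pair_D[of v u] N_sym[of u v] that by fastforce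
    show ?thesis
    proof (cases "\<forall>u\<in>N v. D u = 6")
      case True
      then have "bad v" using two v(2) by (simp add: bad_def)
      then have "- (int (d v) * 5) \<le> gain v"
        using True t_3_le(5)[OF v(2)] by (intro gain_ge) blast
      then show ?thesis using v(2) by simp
    next
      case False
      then obtain q where q: "q \<in> N v" "D q \<noteq> 6" by blast
      then have "7 \<le> D q" using D6[of q] by simp
      then have "t v q \<le> 1" using t_3_le(3)[OF v(2)] by blast
      then have "- 1 \<le> t q v - t v q" using t_nonneg[of q v] by linarith
      moreover have "t v u \<le> 7" if "u \<in> N v" for u
        using t_3_le(2)[OF v(2), of u] D6[OF that] by simp
      ultimately have "- 1 - (int (d v) - 1) * 7 \<le> gain v" using q(1) by (intro gain_remove) auto
      then show ?thesis using v(2) by simp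
    qed
  next
    case large
    then have "d q = 4 \<or> d q = 5" using d_le[OF NV[OF large(1)]] by linarith
    then have "11 \<le> t q v - t v q" using t_3_le(4)[OF v(2), of q] by (auto simp: t_def[of q v])
    then have "11 - (int (d v) - 1) * 11 \<le> gain v"
      using large(1) t_3_le(1)[OF v(2)] by (intro gain_remove) auto
    then show ?thesis using v(2) by simp
  next
    case three
    have "card (N v - {q}) = 2" using three(1) v(2) by simp
    then obtain p r where "N v - {q} = {p, r}" "p \<noteq> r" by (auto simp: card_2_iff)
    then have N: "N v = {q, p, r}" "q \<noteq> p" "q \<noteq> r" "p \<noteq> r" using three(1) by auto
    have "t v q = 0" using t_3_le(4)[OF v(2)] three(2) by simp
    then have "- (t v p + t v r) \<le> gain v"
      using N t_nonneg[of q v] t_nonneg[of p v] t_nonneg[of r v] unfolding gain_def by simp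
    moreover have "t v p + t v r \<le> 17"
    proof (cases "d p = 2 \<and> d r = 2")
      case False
      then have "t v p = 0 \<or> t v r = 0" using t_3_le(4)[OF v(2)] by blast
      then show ?thesis using t_3_le(1)[OF v(2), of p] t_3_le(1)[OF v(2), of r] by auto
    next
      case True
      then have D: "D v = 7" using N three(2) by (simp add: D_def)
      \<comment> \<open>Since \<open>a\<close> may cost 11, \<open>b\<close> must not cost more than
        6. It does not cost 11 by \<open>two_very_light_nbrs\<close>, and not 7 because a bad vertex
        behind it would give the path excluded by \<open>light_chain\<close>.\<close>
      have pair: "t v a + t v b \<le> 17" if ab: "a \<in> N v" "b \<in> N v" "a \<noteq> b" "d a = 2" "d b = 2" "D a = 5" for a b
      proof -
        have "D b \<noteq> 5" using two_very_light_nbrs[of a v b] ab D by auto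
        moreover have False if b: "D b = 6" "w \<in> N b" "w \<noteq> v" "bad w" for w
        proof -
          have "b \<in> N w" using b(2) N_sym by blast
          moreover have "w \<noteq> a" "w \<noteq> b" using b(4) ab(4,5) by (auto simp: bad_def)
          moreover have "v \<noteq> a" "v \<noteq> b" using ab(1,2) N_irrefl by metis+
          ultimately show False using light_chain[of b w v a] ab D b bad_D[OF b(4)] by auto
        qed
        ultimately have "t v b \<le> 6" using t_3_le(6)[OF v(2), of b] by blast
        then show ?thesis using t_3_le(1)[OF v(2), of a] by simp
      qed
      show ?thesis
      proof (cases "D p = 5 \<or> D r = 5")
        case F: True
        then show ?thesis using pair[of p r] pair[of r p] True N by auto
      next
        case False
        then show ?thesis using t_3_le(2)[OF v(2), of p] t_3_le(2)[OF v(2), of r] by simp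
      qed
    qed
    ultimately show ?thesis by simp
  qed
qed

text \<open>The initial charge is \<open>29 * 2 - 70 = - 12\<close>. An end vertex of a 3-thread
  receives 13 and passes 6 on to the middle vertex, which leaves 7. A vertex in \<open>A4\<close>
  receives only 11.\<close>

lemma gain_2:
  assumes v: "v \<in> V" "d v = 2"
  shows "12 + (if v \<in> A5 then - 5 else if v \<in> A4 then - 1 else 0) \<le> gain v"
proof -
  obtain p q where N: "N v = {p, q}" "p \<noteq> q" "d p \<le> d q"
  proof -
    obtain x y where "N v = {x, y}" "x \<noteq> y" using v(2) by (auto simp: card_2_iff)
    then show ?thesis using that[of x y] that[of y x] by (cases "d x \<le> d y") auto
  qed
  have D: "D v = d p + d q" using N by (simp add: D_def)
  have pq: "p \<in> V" "q \<in> V" "p \<in> N v" "q \<in> N v" "v \<in> N p" "v \<in> N q" using N N_sub N_sym by blast+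
  have g: "gain v = t p v - t v p + (t q v - t v q)" using N by (simp add: gain_def)
  have tv: "t v u = (if d u = 2 \<and> D v = 7 then (if D u = 4 then 6 else 1) else 0)" for u
    using v(2) by (simp add: t_def)
  have t3: "t u v = (if D v = 5 then 11
       else if D v = 6 then (if bad u then 5 else if \<exists>w\<in>N v. w \<noteq> u \<and> bad w then 7 else 6)
       else if D v = 7 then 1 else 0)" if "d u = 3" for u
    using v(2) that by (simp add: t_def)
  have t4: "t u v = 11" if "d u = 4" for u using that by (simp add: t_def)
  have t5: "t u v = 13" if "d u = 5" for u using that by (simp add: t_def)
  have t2: "t u v = (if D u = 7 then (if D v = 4 then 6 else 1) else 0)" if "d u = 2" for u
    using v(2) that by (simp add: t_def)
  show ?thesis
  proof (cases "d p = 2")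
    case False
    then have d: "d p \<noteq> 2" "d q \<noteq> 2" using N(3) deg_ge_2[OF pq(1)] by auto
    then have "gain v = t p v + t q v" using g tv by simp
    moreover have "12 \<le> t p v + t q v"
    proof -
      consider "d q = 5" | "d q = 4" "d p = 4" | "d q = 4" "d p = 3" | "d q = 3" "d p = 3"
        using d_cases[OF pq(1)] d_cases[OF pq(2)] d N(3) by fastforce
      then show ?thesis
      proof cases
        case 1
        then show ?thesis using t5[of q] t_nonneg[of p v] by simp
      next
        case 2
        then show ?thesis using t4 by simp
      next
        case 3
        then show ?thesis using t4[of q] t3[of p] D by simp
      next
        case 4
        \<comment> \<open>The vertex receives 6 + 6 if neither neighbour is bad and 5 + 7 if one
          is.\<close>
        have "\<not> (bad p \<and> bad q)" using two_bad[of v p q] pq N(2) by blast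
        then show ?thesis using t3[of p] t3[of q] 4 D pq N(2) by auto
      qed
    qed
    ultimately show ?thesis by simp
  next
    case True
    obtain z where z: "N p = {v, z}" "D p = d v + d z" using two_nbrs[OF True pq(5)] by metis
    then have "z \<in> V" using N_sub by blast
    then have Dp: "D p \<le> 7" using z(2) v(2) d_le by fastforce
    consider "d q = 5" | "d q = 4" | "d q = 3" | "d q = 2" using d_cases[OF pq(2)] by blast
    then show ?thesis
    proof cases
      case 1
      have "v \<in> A5" if "D p = 4" using v D 1 True that pq(3) by (auto simp: A5_def)
      then show ?thesis using 1 g tv[of p] tv[of q] t5[of q] t_nonneg[of p v] True D by auto
    next
      case 2
      then have D6: "D v = 6" using D True by simp
      then have "\<not> D p \<le> 5" using light_pair_D[of v p] pq by auto
      then have "D p = 6 \<or> D p = 7" using Dp by linarith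
      moreover have "v \<in> A4" if "D p = 6" using v D6 True that pq(3) by (auto simp: A4_def)
      moreover have "v \<notin> A5" using D6 by (simp add: A5_def)
      ultimately show ?thesis using 2 g tv[of p] tv[of q] t4[of q] t2[OF True] True D6 by auto
    next
      case 3
      then have D5: "D v = 5" using D True by simp
      \<comment> \<open>The other neighbour of \<open>p\<close> is therefore a 5-vertex, so
        \<open>p\<close> adds 1 to the 11 from \<open>q\<close>.\<close>
      then have "\<not> D p \<le> 6" using light_pair_D[of p v] pq by auto
      then show ?thesis using Dp 3 g tv[of p] tv[of q] t3[of q] t2[OF True] D5 by (auto simp: A5_def A4_def)
    next
      case 4
      then have D4: "D v = 4" using D True by simp
      obtain y where y: "N q = {v, y}" "D q = d v + d y" using two_nbrs[OF 4 pq(6)] by metis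
      then have "y \<in> V" using N_sub by blast
      then have "D q \<le> 7" using y(2) v(2) d_le by fastforce
      \<comment> \<open>Here \<open>v\<close> is the middle of a 3-thread and receives 6 from either
        side.\<close>
      moreover have "\<not> D p \<le> 6" "\<not> D q \<le> 6" using light_pair_D[of p v] light_pair_D[of q v] pq D4 by auto
      ultimately show ?thesis
        using Dp g tv[of p] tv[of q] t2[OF True] t2[OF 4] D4 by (auto simp: A5_def A4_def)
    qed
  qed
qed

lemma sum_gain: "(\<Sum>v\<in>V. gain v) = 0"
proof -
  have N: "N v = {u \<in> V. (v, u) \<in> E}" "N v = {u \<in> V. (u, v) \<in> E}" for v
    using E_sub sym by (auto simp: N_iff)
  have "(\<Sum>v\<in>V. \<Sum>u\<in>N v. t u v) = (\<Sum>v\<in>V. \<Sum>u\<in>{u \<in> V. (v, u) \<in> E}. t u v)" by (simp add: N(1))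
  also have "\<dots> = (\<Sum>u\<in>V. \<Sum>v\<in>{v \<in> V. (v, u) \<in> E}. t u v)"
    by (rule sum.swap_restrict[OF finite_V finite_V])
  also have "\<dots> = (\<Sum>u\<in>V. \<Sum>v\<in>N u. t u v)" by (simp add: N(2))
  finally show ?thesis by (simp add: gain_def sum_subtractf)
qed

lemma card_E_ge: "70 * card V \<le> 29 * card E"
proof -
  have "E = Sigma V N" using E_sub by (auto simp: N_iff)
  then have "card E = card (Sigma V N)" by (rule arg_cong)
  also have "\<dots> = (\<Sum>v\<in>V. d v)" using finite_V by (intro card_SigmaI) auto
  finally have E: "card E = (\<Sum>v\<in>V. d v)" .
  let ?w = "\<lambda>v. (if d v = 5 then 10 else 0) + (if d v = 4 then 2 else 0)
    - (if v \<in> A5 then 5 else 0) - (if v \<in> A4 then 1 else 0) :: int"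
  have w: "?w v \<le> 29 * int (d v) - 70 + gain v" if v: "v \<in> V" for v
  proof -
    have A: "v \<in> A5 \<Longrightarrow> d v = 2 \<and> v \<notin> A4" "v \<in> A4 \<Longrightarrow> d v = 2" by (auto simp: A5_def A4_def)
    consider "d v = 2" | "d v = 3" | "d v = 4" | "d v = 5" using d_cases[OF v] by blast
    then show ?thesis
    proof cases
      case 1
      then show ?thesis using gain_2[OF v 1] A by (auto split: if_splits)
    next
      case 2
      then show ?thesis using gain_3[OF v 2] A by auto
    next
      case 3
      then have "- (int (d v) * 11) \<le> gain v" by (intro gain_ge) (simp add: t_def)
      then show ?thesis using 3 A by auto
    next
      case 4
      then have "- (int (d v) * 13) \<le> gain v" by (intro gain_ge) (simp add: t_def)
      then show ?thesis using 4 A by auto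
    qed
  qed
  have cnt: "(\<Sum>v\<in>V. if P v then k else 0) = k * int (card {v \<in> V. P v})" for P and k :: int
    using finite_V by (simp add: sum.If_cases Int_def)
  have "A5 = {v \<in> V. v \<in> A5}" "A4 = {v \<in> V. v \<in> A4}" by (auto simp: A5_def A4_def)
  then have "(\<Sum>v\<in>V. ?w v) = 10 * int (card {v \<in> V. d v = 5}) + 2 * int (card {v \<in> V. d v = 4})
      - 5 * int (card A5) - int (card A4)"
    by (simp add: sum_subtractf sum.distrib cnt)
  \<comment> \<open>There are at most two vertices of \<open>A5\<close> per 5-vertex and two of
    \<open>A4\<close> per 4-vertex, and \<open>10 = 2 * 5\<close>, \<open>2 = 2 * 1\<close>.\<close>
  then have "0 \<le> (\<Sum>v\<in>V. ?w v)" using card_A5 card_A4 by linarith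
  also have "\<dots> \<le> (\<Sum>v\<in>V. 29 * int (d v) - 70 + gain v)" using w by (intro sum_mono)
  also have "\<dots> = 29 * int (card E) - 70 * int (card V)"
    by (simp add: sum.distrib sum_subtractf sum_gain E sum_distrib_left)
  finally show ?thesis by linarith
qed

end

subsection \<open>From maximum average degree to critical graphs\<close>

text \<open>The density hypothesis passes to all subgraphs, so a smallest counterexample in terms of
  \<open>card V + card E\<close> is \<open>critical\<close>. As \<open>E'\<close> holds both
  orientations of its edges, \<open>card E' / card V'\<close> is the average degree, and
  \<open>70 / 29 = 2 + 12 / 29\<close>.\<close>

lemma sparse_square_list_colorable:
  fixes L :: "'a \<Rightarrow> 'c set"
  assumes "finite V" "E \<subseteq> V \<times> V" "\<And>u v. (u, v) \<in> E \<Longrightarrow> (v, u) \<in> E" "\<And>v. (v, v) \<notin> E"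
    and "\<And>v. v \<in> V \<Longrightarrow> card (E `` {v}) \<le> 5"
    and "\<And>v. v \<in> V \<Longrightarrow> finite (L v) \<and> 6 \<le> card (L v)"
    and "\<And>V' E'. \<lbrakk>V' \<subseteq> V; E' \<subseteq> E; E' \<subseteq> V' \<times> V'; \<And>u v. (u, v) \<in> E' \<Longrightarrow> (v, u) \<in> E'; V' \<noteq> {}\<rbrakk>
      \<Longrightarrow> 29 * card E' < 70 * card V'"
  shows "\<exists>c. square_coloring E L V c"
  using assms
proof (induction "card V + card E" arbitrary: V E rule: less_induct)
  case less
  note finV = less.prems(1) and EV = less.prems(2) and symE = less.prems(3) and sparse = less.prems(7)
  have finE: "finite E" using finite_subset[OF EV] finV by simp
  show ?case
  proof (rule ccontr)
    assume no: "\<nexists>c. square_coloring E L V c"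
    have "critical V E L"
    proof
      fix V' E'
      assume sub: "V' \<subseteq> V" "E' \<subseteq> E" "E' \<subseteq> V' \<times> V'" "V' \<noteq> V \<or> E' \<noteq> E"
        and sym': "\<And>u v. (u, v) \<in> E' \<Longrightarrow> (v, u) \<in> E'"
      have "card V' \<le> card V" "card E' \<le> card E" using sub(1,2) finV finE by (auto intro: card_mono)
      moreover have "card V' < card V \<or> card E' < card E"
        using sub finV finE by (metis psubset_card_mono psubsetI)
      ultimately have "card V' + card E' < card V + card E" by linarith
      then show "\<exists>c. square_coloring E' L V' c"
      proof (rule less.hyps)
        show "finite V'" using finite_subset[OF sub(1) finV] .
        show "card (E' `` {v}) \<le> 5" if "v \<in> V'" for v
        proof -
          have "finite (E `` {v})" using finE by (rule finite_Image)
          then have "card (E' `` {v}) \<le> card (E `` {v})" using sub(2) by (intro card_mono) auto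
          then show ?thesis using less.prems(5)[of v] sub(1) that by auto
        qed
        show "29 * card F < 70 * card W"
          if "W \<subseteq> V'" "F \<subseteq> E'" "F \<subseteq> W \<times> W" "\<And>u v. (u, v) \<in> F \<Longrightarrow> (v, u) \<in> F" "W \<noteq> {}" for W F
          using that sub by (intro sparse) auto
      qed (use sub sym' less.prems(4,6) in auto)
    qed (use no finV EV symE less.prems(4-6) in auto)
    then have "70 * card V \<le> 29 * card E" by (rule critical.card_E_ge)
    moreover have "V \<noteq> {}" using no by (auto simp: square_coloring_def)
    ultimately show False using sparse[of V E] EV symE by auto
  qed
qed

section \<open>Translation from the digraph representation\<close>

lemma card_parcs_eq:
  assumes "pair_graph H"
  shows "card (parcs H) = 2 * card (uedges H)"
proof -
  interpret pair_graph H by (fact assms)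
  let ?f = "\<lambda>(u, v). {u, v}"
  have "card {e \<in> parcs H. ?f e = X} = 2" if X: "X \<in> uedges H" for X
  proof -
    obtain u v where uv: "(u, v) \<in> parcs H" "X = {u, v}" using X by (auto simp: uedges_def)
    moreover have "(v, u) \<in> parcs H" "u \<noteq> v"
      using arcs_symmetric[OF uv(1)] pair_no_loops[OF uv(1)] by auto
    ultimately have "{e \<in> parcs H. ?f e = X} = {(u, v), (v, u)}" by (auto simp: doubleton_eq_iff)
    then show ?thesis using \<open>u \<noteq> v\<close> by simp
  qed
  then have "(\<Sum>X\<in>uedges H. card {e \<in> parcs H. ?f e = X}) = (\<Sum>X\<in>uedges H. 2)"
    by (intro sum.cong) auto
  moreover have "(\<Sum>X\<in>uedges H. card {e \<in> parcs H. ?f e = X}) = card (parcs H)"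
    using sum.group[OF pair_finite_arcs, of "uedges H" ?f "\<lambda>_. 1 :: nat"] pair_finite_arcs
    by (simp add: uedges_def)
  ultimately show ?thesis by simp
qed

lemma subgraph_avg_le_mad:
  assumes G: "pair_graph G" and H: "pair_graph H" "subgraph (with_proj H) (with_proj G)" "pverts H \<noteq> {}"
  shows "card (parcs H) / card (pverts H) \<le> mad G"
proof -
  let ?A = "\<lambda>H. 2 * real (card (uedges H)) / real (card (pverts H))"
  let ?S = "{?A H | H. pair_graph H \<and> subgraph (with_proj H) (with_proj G) \<and> pverts H \<noteq> {}}"
  have "?S \<subseteq> ?A ` {H. pair_graph H \<and> subgraph (with_proj H) (with_proj G)}" by blast
  then have "finite ?S" using finite_subgraphs[OF G] finite_surj by blast
  moreover have "?A H \<in> ?S" using H by blast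
  ultimately have "?A H \<le> mad G" unfolding mad_def by (intro Max_ge) auto
  then show ?thesis using card_parcs_eq[OF H(1)] by simp
qed

lemma square_nbrs_if_distance_le_2:
  assumes G: "pair_graph G" and uv: "u \<noteq> v" "distance G u v \<le> 2"
  shows "v \<in> square_nbrs (parcs G) u"
proof -
  interpret pair_graph G by (fact G)
  \<comment> \<open>Relaxing the bound 2 to a strict 3 gives an actual walk below it from the
    infimum, and its length, being integral, is at most 2.\<close>
  have "(INF p\<in>{p. awalk u p v}. ereal (awalk_cost (\<lambda>_. 1) p)) < 3"
    using uv(2) unfolding distance_def \<mu>_def by (rule order_le_less_trans) simp
  then obtain p where p: "awalk u p v" "ereal (awalk_cost (\<lambda>_. 1) p) < 3"
    unfolding INF_less_iff by blast
  have "awalk_cost (\<lambda>_. 1) p = length p" by (simp add: awalk_cost_def sum_list_triv)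
  then have "length p < 3" using p(2) by simp
  then consider "p = []" | e where "p = [e]" | e f where "p = [e, f]"
    by (cases p; cases "tl p"; cases "tl (tl p)") auto
  then show ?thesis
    using p(1) uv(1) by cases (auto simp: awalk_simps square_nbrs_def)
qed

theorem theorem4:
  fixes G :: "'a pair_pre_digraph"
  assumes "pair_graph G"
    and "max_degree G \<le> 5"
    and "mad G < 2 + 12 / 29"
  shows "choice_number (square G) \<le> 6"
proof -
  interpret pair_graph G by (fact assms(1))
  let ?V = "pverts G" and ?E = "parcs G"
  have deg: "card (?E `` {v}) \<le> 5" if "v \<in> ?V" for v
  proof -
    have "out_arcs (with_proj G) v = Pair v ` (?E `` {v})" by (auto simp: out_arcs_def)
    then have "out_degree (with_proj G) v = card (?E `` {v})"
      by (simp add: out_degree_def card_image inj_on_def)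
    moreover have "out_degree (with_proj G) v \<le> max_degree G"
      unfolding max_degree_def using that pair_finite_verts by (intro Max_ge) auto
    ultimately show ?thesis using assms(2) by simp
  qed
  have sparse: "29 * card E' < 70 * card V'"
    if sub: "V' \<subseteq> ?V" "E' \<subseteq> ?E" "E' \<subseteq> V' \<times> V'" "V' \<noteq> {}"
      and sym: "\<And>u v. (u, v) \<in> E' \<Longrightarrow> (v, u) \<in> E'" for V' E'
  proof -
    let ?H = "\<lparr>pverts = V', parcs = E'\<rparr>"
    have fin: "finite V'" "finite E'"
      using finite_subset[OF sub(1) pair_finite_verts] finite_subset[OF sub(2) pair_finite_arcs] .
    have H: "pair_graph ?H"
      using fin sub sym pair_no_loops by unfold_locales (auto simp: symmetric_def sym_def)
    then interpret H: pair_graph ?H .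
    have "subgraph (with_proj ?H) (with_proj G)"
      using sub H.wf_digraph_axioms wf_digraph_axioms by (auto simp: subgraph_def compatible_def)
    then have "card E' / card V' \<le> mad G"
      using subgraph_avg_le_mad[OF assms(1) H] sub(4) by simp
    moreover have "mad G < 70 / 29" using assms(3) by simp
    ultimately have "card E' / card V' < 70 / 29" by linarith
    moreover have "0 < card V'" using fin sub(4) by (simp add: card_gt_0_iff)
    ultimately have "real (29 * card E') < real (70 * card V')" by (simp add: field_simps)
    then show ?thesis by linarith
  qed
  have "choosable (square G) 6"
    unfolding choosable_def
  proof (intro allI impI)
    fix L :: "'a \<Rightarrow> nat set"
    assume L: "\<forall>v\<in>pverts (square G). infinite (L v) \<or> 6 \<le> card (L v)"
    \<comment> \<open>Lists may be infinite here, whereas \<open>critical\<close> works with finite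
      ones; they are cut down to six colours.\<close>
    have "\<exists>S. S \<subseteq> L v \<and> finite S \<and> card S = 6" if "v \<in> ?V" for v
    proof -
      have "infinite (L v) \<or> 6 \<le> card (L v)" using L that by (simp add: square_def)
      then show ?thesis by (metis infinite_arbitrarily_large obtain_subset_with_card_n)
    qed
    then obtain S where S: "\<And>v. v \<in> ?V \<Longrightarrow> S v \<subseteq> L v \<and> finite (S v) \<and> card (S v) = 6" by metis
    have "\<exists>c. square_coloring ?E S ?V c"
    proof (rule sparse_square_list_colorable)
      show "finite ?V" by (fact pair_finite_verts)
      show "?E \<subseteq> ?V \<times> ?V" using in_arcsD1 in_arcsD2 by auto
      show "(v, u) \<in> ?E" if "(u, v) \<in> ?E" for u v using arcs_symmetric[OF that] .
      show "(v, v) \<notin> ?E" for v using pair_no_loops by fastforce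
    qed (use S deg sparse in auto)
    then obtain c where c: "square_coloring ?E S ?V c" ..
    have "list_coloring (square G) L c"
      unfolding list_coloring_def
    proof (intro conjI ballI)
      show "c v \<in> L v" if "v \<in> pverts (square G)" for v
        using that c S by (auto simp: square_def square_coloring_def)
      fix e assume "e \<in> parcs (square G)"
      then obtain u v where e: "e = (u, v)" "u \<in> ?V" "v \<in> ?V" "u \<noteq> v" "distance G u v \<le> 2"
        by (auto simp: square_def)
      then have "v \<in> square_nbrs ?E u" using square_nbrs_if_distance_le_2[OF assms(1)] by blast
      then have "c v \<noteq> c u" using c e(2,3) unfolding square_coloring_def by blast
      then show "case e of (u, v) \<Rightarrow> c u \<noteq> c v" using e(1) by simp
    qed
    then show "\<exists>c. list_coloring (square G) L c" by blast
  qed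
  then show ?thesis unfolding choice_number_def by (rule Least_le)
qed

end
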